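(* Let $r\ge1$ and $(m,N)=(2r,4r)$. For each partition $\lambda$ of $4$ and $x\in\mathrm{Mat}(r)$ consider the $2r\times4r$ matrix $\mathbf x_\lambda=\mathbf x_\lambda(x)$: $$\mathbf x_{(1,1,1,1)}=\begin{pmatrix}1_r&0&1_r&1_r\\0&1_r&-1_r&-x\end{pmatrix},\quad \mathbf x_{(2,1,1)}=\begin{pmatrix}1_r&0&0&1_r\\0&x&1_r&-1_r\end{pmatrix},\quad \mathbf x_{(2,2)}=\begin{pmatrix}1_r&0&0&1_r\\0&x&1_r&0\end{pmatrix},$$ $$\mathbf x_{(3,1)}=\begin{pmatrix}1_r&0&0&0\\0&1_r&x&1_r\end{pmatrix},\quad \mathbf x_{(4)}=\begin{pmatrix}1_r&0&0&0\\0&1_r&0&x\end{pmatrix},$$ where $x$ is such that $\mathbf x_\lambda\in Z_\lambda$. In the affine coordinates $u\in\mathrm{Mat}(r)$ the Radon hypergeometric function of type $\lambda$ at $\mathbf x_\lambda$, with $\alpha=(\alpha_1,\alpha_2,\alpha_3,\alpha_4)\in\mathbb C^4$, is $$F_{(1,1,1,1)}=\int_C(\det u)^{\alpha_2}(\det(1_r-u))^{\alpha_3}(\det(1_r-ux))^{\alpha_4}du,$$ $$F_{(2,1,1)}=\int_C e^{\alpha_2\mathrm{Tr}(ux)}(\det u)^{\alpha_3}(\det(1_r-u))^{\alpha_4}du,$$ $$F_{(2,2)}=\int_Ce^{\alpha_2\mathrm{Tr}(ux)}(\det u)^{\alpha_3}e^{\alpha_4\mathrm{Tr}(u^{-1})}du,$$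 $$F_{(3,1)}=\int_Ce^{\alpha_2\mathrm{Tr}(u)+\alpha_3\mathrm{Tr}(ux-\frac12u^2)}(\det u)^{\alpha_4}du,$$ $$F_{(4)}=\int_Ce^{\alpha_2\mathrm{Tr}(u)+\alpha_3\mathrm{Tr}(-\frac12u^2)+\alpha_4\mathrm{Tr}(ux-\frac13u^3)}du.$$ Moreover, let $\mathscr H(r)$ be the real vector space of $r\times r$ complex Hermitian matrices with Euclidean volume form $dU$. It is a real form of $\mathrm{Mat}(r)$, and the restriction of $du$ to $\mathscr H(r)$ coincides with $dU$ up to a constant, so the chain $C$ may be chosen as an $r^2$-chain in $\mathscr H(r)$. Impose on $\alpha$ the additional conditions $(2,1,1)$: $\alpha_2=1$; $(2,2)$: $\alpha_2=1,\ \alpha_4=-1$; $(3,1)$: $\alpha_2=0,\ \alpha_3=1$; $(4)$: $\alpha_2=\alpha_3=0,\ \alpha_4=1$ (no additional condition for $(1,1,1,1)$). Then, with $x=X\in\mathscr H(r)$ and $C$ a chain in $\mathscr H(r)$, $F_\lambda(\mathbf x_\lambda,\alpha;C)$ gives, up to a constant factor, the Hermitian matrix integral analogues of the Gauss, Kummer, Bessel, Hermite–Weber and Airy functions for $\lambda=(1,1,1,1),(2,1,1),(2,2),(3,1),(4)$ respectively. With $\mathrm{etr}(A)=\exp(\mathrm{Tr}A)$ these are: (Gauss) $\lambda=(1,1,1,1)$, naming $\alpha_2=a-r,\ \alpha_3=c-a-r,\ \alpha_4=-b$: $\displaystyle\frac{\Gamma_r(c)}{\Gamma_r(a)\Gamma_r(c-a)}\int_{0<U<1_r}(\det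 U)^{a-r}(\det(1_r-U))^{c-a-r}(\det(1_r-UX))^{-b}dU$; (Kummer) $\lambda=(2,1,1)$, naming $\alpha_3=a-r,\ \alpha_4=c-a-r$: $\displaystyle\int_C\mathrm{etr}(UX)(\det U)^{a-r}(\det(1_r-U))^{c-a-r}dU$; (Bessel) $\lambda=(2,2)$, naming $\alpha_3=c-r$: $\displaystyle\int_C\mathrm{etr}(UX-U^{-1})(\det U)^{c-r}dU$; (Hermite–Weber) $\lambda=(3,1)$, naming $\alpha_4=-c-r$: $\displaystyle\int_C\mathrm{etr}\left(UX-\tfrac12U^2\right)(\det U)^{-c-r}dU$; (Airy) $\lambda=(4)$: $\displaystyle\int_C\mathrm{etr}\left(UX-\tfrac13U^3\right)dU$.
   Context: All matrices are complex unless stated otherwise; $\mathrm{Mat}(p,q)$ is the space of $p\times q$ matrices, $\mathrm{Mat}(r)=\mathrm{Mat}(r,r)$, $\mathrm{Mat}'(p,q)$ the set of matrices of maximal rank. Let $\lambda=(n_1,\dots,n_\ell)$ be a partition of $n=4$, $m=2r$, $N=4r$. Jordan group and character. $J_r(p)=(\mathrm{Mat}(r)[w]/(w^p))^\times$, i.e. the group of elements $h=\sum_{0\le i<p}h_iw^i$ with $h_0\in \mathrm{GL}(r)$, and $H_\lambda=\prod_jJ_r(n_j)$. For $h=1_r+\sum_{1\le i<p}h_iw^i$, $\theta_k(h)\in\mathrm{Mat}(r)$ is defined by $\log h=\sum_{1\le k<p}\theta_k(h)w^k$. For $h=\sum h_iw^i\in J_r(p)$ put $\underline h=\sum_i(h_0^{-1}h_i)w^i$.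 For $\alpha=(\alpha^{(1)},\dots,\alpha^{(\ell)})$, $\alpha^{(j)}=(\alpha^{(j)}_0,\dots,\alpha^{(j)}_{n_j-1})\in\mathbb C^{n_j}$, the character of the universal covering group of $H_\lambda$ is $\chi_\lambda(h;\alpha)=\prod_{j}(\det h_0^{(j)})^{\alpha_0^{(j)}}\exp\left(\sum_{1\le k<n_j}\alpha_k^{(j)}\mathrm{Tr}\,\theta_k(\underline{h^{(j)}})\right)$. The entries of $(\alpha^{(1)},\dots,\alpha^{(\ell)})$, listed in order, are denoted $\alpha_1,\alpha_2,\alpha_3,\alpha_4$. Assumptions on $\alpha$: (i) $\alpha^{(j)}_0\notin\mathbb Z$ for $1\le j\le\ell$; (ii) $\alpha^{(j)}_{n_j-1}\ne0$ if $n_j\ge2$; (iii) $\alpha^{(1)}_0+\cdots+\alpha^{(\ell)}_0=-m=-2r$. Through $(h^{(1)},\dots,h^{(\ell)})\mapsto(h_0^{(1)},\dots,h^{(1)}_{n_1-1},\dots,h^{(\ell)}_0,\dots,h^{(\ell)}_{n_\ell-1})$ the group $H_\lambda$ is identified with a Zariski open subset of $\mathrm{Mat}'(r,4r)$ and $\chi_\lambda$ is regarded as a multivalued analytic function there. Radon hypergeometric function. $F_\lambda(z,\alpha;C)=\int_{C}\chi_\lambda(tz;\alpha)\,\tau(t)$, where $t=(t',t'')\in\mathrm{Mat}'(r,2r)$, $t',t''\in \mathrm{Mat}(r)$, are homogeneous coordinates of $T=\mathrm{Gr}(r,2r)=\mathrm{GL}(r)\backslash\mathrm{Mat}'(r,2r)$,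 and $\tau(t)=(\det t')^{2r}du$ with $u=(t')^{-1}t''=(u_{i,j})$, $du=\bigwedge_{i,j}du_{i,j}$ in the chart $\det t'\ne0$. Here $z=(z^{(1)},\dots,z^{(\ell)})$, $z^{(j)}=(z_0^{(j)},\dots,z_{n_j-1}^{(j)})$, $z_k^{(j)}\in\mathrm{Mat}(2r,r)$. Put $X_z=T\setminus\bigcup_j\{[t]:\det(tz^{(j)}_0)=0\}$ and let $\mathcal L_z$ be the rank one local system on $X_z$ given by the monodromy of $\chi_\lambda(tz;\alpha)\tau(t)$. $C=C(z)$ is an $r^2$-cycle of the homology of locally finite chains of $X_z$ with coefficients in $\mathcal L_z$; when $\lambda\ne(1,1,1,1)$ the family of supports consists of the closed $A\subset X_z$ such that $A\cap\{\mathrm{Re}\,g_z\ge a\}$ is compact for every $a\in\mathbb R$, where $g_z(t)=\sum_j\sum_{1\le k<n_j}\alpha^{(j)}_k\mathrm{Tr}\,\theta_k(\underline{tz^{(j)}})$ is the exponent of $\chi_\lambda(tz;\alpha)$. In the affine chart, $F_\lambda(z,\alpha;C)=\int_C\chi_\lambda((1_r,u)z;\alpha)\,du$. $Z_\lambda$ is the set of $z\in\mathrm{Mat}(2r,4r)$ such that $\det(z_0^{(i)},z_0^{(j)})\neq0$ for all $i\neq j$ and $\det(z_0^{(i)},z_1^{(i)})\ne0$ for all $i$ with $n_i\ge2$. On $\mathscr H(r)$, $dU=\bigwedge_{i}dU_{i,i}\wedge\bigwedge_{i<j}\left(d\,\mathrm{Re}(U_{i,j})\wedge d\,\mathrm{Im}(U_{i,j})\right)$;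 $U>0$ means positive definite, $0<U<1_r$ means $U>0$ and $1_r-U>0$; and $\Gamma_r(a)=\int_{U>0}\mathrm{etr}(-U)(\det U)^{a-r}dU$. The domains of integration $C$ of the Kummer, Bessel, Hermite–Weber and Airy matrix integrals are left unspecified.
   Formalization: For λ=(4) the term −u³/3 is corrected to +u³/3 (as θ_3 requires); the Airy integral with −U³/3 is obtained at x=−X, α_4=−1 instead of x=X, α_4=1, and non-integrality of α_0, incompatible with α_0=−2r, is dropped there. *)

theory Defs
  imports "HOL-Analysis.Analysis" "HOL-Homology.Homology"
begin

section \<open>Matrices\<close>

text \<open>
  \<open>r\<close> is \<open>CARD('r)\<close>, and \<open>2r\<close> rows or columns are indexed by \<open>'r + 'r\<close>.  A
  \<open>2r \<times> 4r\<close> matrix is the list of its four consecutive \<open>2r \<times> r\<close> column blocks.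
  The order on \<open>'r\<close> is only used to order the matrix entries (orientations, and the
  real coordinates on Hermitian matrices); as \<open>'r\<close> is finite, \<open>wellorder\<close> just means
  linearly ordered.
\<close>

type_synonym 'r cmat = "complex^'r^'r"
type_synonym 'r tmat = "complex^('r + 'r)^'r"
type_synonym 'r zblock = "complex^'r^('r + 'r)"

definition hcat :: "'a^'n^'m \<Rightarrow> 'a^'k^'m \<Rightarrow> 'a^('n + 'k)^'m" where
  "hcat A B = (\<chi> i j. case j of Inl a \<Rightarrow> A $ i $ a | Inr b \<Rightarrow> B $ i $ b)"

definition vcat :: "'a^'n^'m \<Rightarrow> 'a^'n^'k \<Rightarrow> 'a^'n^('m + 'k)" where
  "vcat A B = (\<chi> i j. case i of Inl a \<Rightarrow> A $ a $ j | Inr b \<Rightarrow> B $ b $ j)"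

definition lpart :: "'r::finite tmat \<Rightarrow> 'r cmat" where
  "lpart t = (\<chi> i j. t $ i $ Inl j)"

definition rpart :: "'r::finite tmat \<Rightarrow> 'r cmat" where
  "rpart t = (\<chi> i j. t $ i $ Inr j)"

definition etr :: "'r::finite cmat \<Rightarrow> complex" where
  "etr A = exp (trace A)"

definition mpow :: "complex \<Rightarrow> complex \<Rightarrow> complex set" where
  \<comment> \<open>all values of the multivalued power \<open>w\<^sup>a\<close>\<close>
  "mpow w a = {exp (a * l) | l. exp l = w}"


section \<open>The Jordan group and its character\<close>

text \<open>
  An element of \<open>Mat(r)[w]/(w^p)\<close> is given by its coefficients \<open>h k\<close>, \<open>k < p\<close>; coefficients
  with \<open>k \<ge> p\<close> are ignored by everything below.
\<close>

definition jone :: "nat \<Rightarrow> 'r::finite cmat" where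
  "jone k = (if k = 0 then mat 1 else 0)"

definition jmul :: "(nat \<Rightarrow> 'r::finite cmat) \<Rightarrow> (nat \<Rightarrow> 'r cmat) \<Rightarrow> nat \<Rightarrow> 'r cmat" where
  "jmul f g k = (\<Sum>i\<le>k. f i ** g (k - i))"

primrec jpow :: "(nat \<Rightarrow> 'r::finite cmat) \<Rightarrow> nat \<Rightarrow> nat \<Rightarrow> 'r cmat" where
  "jpow f 0 = jone"
| "jpow f (Suc n) = jmul f (jpow f n)"

text \<open>
  For \<open>h\<^sub>0 = 1\<close> the power \<open>(h - 1)^p\<close> vanishes modulo \<open>w^p\<close>, so the logarithmic series stops
  at \<open>n = p - 1\<close>.
\<close>

definition jtheta :: "nat \<Rightarrow> (nat \<Rightarrow> 'r::finite cmat) \<Rightarrow> nat \<Rightarrow> 'r cmat" where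
  "jtheta p h k =
     (\<Sum>n = 1..<p. ((- 1) ^ (n + 1) / real n) *\<^sub>R jpow (\<lambda>i. h i - jone i) n k)"

definition junder :: "(nat \<Rightarrow> 'r::finite cmat) \<Rightarrow> nat \<Rightarrow> 'r cmat" where
  "junder h i = matrix_inv (h 0) ** h i"

text \<open>
  A partition, written \<open>\<mu>\<close> because \<open>\<lambda>\<close> is the binder, is the list of its parts, with
  blocks numbered from \<open>0\<close>.  The entry
  \<open>\<alpha>\<^sup>(\<^sup>j\<^sup>)\<^sub>k\<close> is \<open>\<alpha> ! (offs \<mu> j + k)\<close>, and likewise for the column blocks of \<open>z\<close>.
\<close>

definition offs :: "nat list \<Rightarrow> nat \<Rightarrow> nat" where
  "offs \<mu> j = sum_list (take j \<mu>)"

definition expo :: "nat list \<Rightarrow> complex list \<Rightarrow> (nat \<Rightarrow> nat \<Rightarrow> 'r::finite cmat) \<Rightarrow> complex" where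
  "expo \<mu> \<alpha> h =
     (\<Sum>j<length \<mu>. \<Sum>k = 1..<\<mu> ! j. \<alpha> ! (offs \<mu> j + k) * trace (jtheta (\<mu> ! j) (junder (h j)) k))"

text \<open>
  The universal cover of \<open>GL(r)\<close> is \<open>{(g, l). exp l = det g}\<close>, so a point of the universal cover
  of \<open>H\<^sub>\<mu>\<close> is \<open>h\<close> together with a logarithm \<open>l j\<close> of each \<open>det h\<^sup>(\<^sup>j\<^sup>)\<^sub>0\<close>.
\<close>

definition chi :: "nat list \<Rightarrow> complex list \<Rightarrow> (nat \<Rightarrow> nat \<Rightarrow> 'r::finite cmat) \<Rightarrow> (nat \<Rightarrow> complex) \<Rightarrow> complex" where
  "chi \<mu> \<alpha> h l = (\<Prod>j<length \<mu>. exp (\<alpha> ! offs \<mu> j * l j)) * exp (expo \<mu> \<alpha> h)"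

definition chi_values :: "nat list \<Rightarrow> complex list \<Rightarrow> (nat \<Rightarrow> nat \<Rightarrow> 'r::finite cmat) \<Rightarrow> complex set" where
  "chi_values \<mu> \<alpha> h = {chi \<mu> \<alpha> h l | l. \<forall>j<length \<mu>. exp (l j) = det (h j 0)}"

text \<open>
  If \<open>\<mu>\<close> has a single part, the sum condition forces \<open>\<alpha>\<^sup>(\<^sup>1\<^sup>)\<^sub>0 = - 2r\<close>, which contradicts the
  non-integrality condition; the latter is therefore only imposed when there are at least two
  parts.
\<close>

definition alpha_ok :: "nat list \<Rightarrow> nat \<Rightarrow> complex list \<Rightarrow> bool" where
  "alpha_ok \<mu> r \<alpha> \<longleftrightarrow>
     length \<alpha> = sum_list \<mu> \<and>
     (2 \<le> length \<mu> \<longrightarrow> (\<forall>j<length \<mu>. \<alpha> ! offs \<mu> j \<notin> \<int>)) \<and>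
     (\<forall>j<length \<mu>. 2 \<le> \<mu> ! j \<longrightarrow> \<alpha> ! (offs \<mu> j + (\<mu> ! j - 1)) \<noteq> 0) \<and>
     (\<Sum>j<length \<mu>. \<alpha> ! offs \<mu> j) = - of_nat (2 * r)"


section \<open>The Grassmannian and the complement of the arrangement\<close>

definition maxrank :: "'r::finite tmat set" where
  "maxrank = {t. rank t = CARD('r)}"

definition gl_orbit :: "'r::finite tmat \<Rightarrow> 'r tmat set" where
  "gl_orbit t = {g ** t | g. invertible g}"

text \<open>
  A point of \<open>Gr(r, 2r)\<close> is the set of its homogeneous coordinates; the topology is the
  quotient topology.
\<close>

definition gr_topology :: "'r::finite tmat set topology" where
  "gr_topology = topology (\<lambda>U. U \<subseteq> gl_orbit ` maxrank \<and>
     openin (top_of_set maxrank) {t \<in> maxrank. gl_orbit t \<in> U})"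

lemma openin_gr_topology:
  "openin gr_topology U \<longleftrightarrow> U \<subseteq> gl_orbit ` maxrank \<and>
     openin (top_of_set maxrank) {t \<in> maxrank. gl_orbit t \<in> U}"
proof -
  have "istopology (\<lambda>U. U \<subseteq> gl_orbit ` (maxrank :: 'a tmat set) \<and>
     openin (top_of_set maxrank) {t \<in> maxrank. gl_orbit t \<in> U})"
    unfolding istopology_def
  proof (intro conjI allI impI)
    fix S T :: "'a tmat set set"
    assume S: "S \<subseteq> gl_orbit ` maxrank \<and> openin (top_of_set maxrank) {t \<in> maxrank. gl_orbit t \<in> S}"
      and T: "T \<subseteq> gl_orbit ` maxrank \<and> openin (top_of_set maxrank) {t \<in> maxrank. gl_orbit t \<in> T}"
    have "{t \<in> maxrank. gl_orbit t \<in> S \<inter> T} =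
        {t \<in> maxrank. gl_orbit t \<in> S} \<inter> {t \<in> maxrank. gl_orbit t \<in> T}"
      by auto
    then show "openin (top_of_set maxrank) {t \<in> maxrank. gl_orbit t \<in> S \<inter> T}"
      using S T by (simp add: openin_Int)
    show "S \<inter> T \<subseteq> gl_orbit ` maxrank"
      using S by auto
  next
    fix K :: "'a tmat set set set"
    assume K: "\<forall>S\<in>K. S \<subseteq> gl_orbit ` maxrank \<and> openin (top_of_set maxrank) {t \<in> maxrank. gl_orbit t \<in> S}"
    have "{t \<in> maxrank. gl_orbit t \<in> \<Union> K} = (\<Union>S\<in>K. {t \<in> maxrank. gl_orbit t \<in> S})"
      by auto
    also have "openin (top_of_set maxrank) \<dots>"
      using K by (intro openin_Union) auto
    finally show "openin (top_of_set maxrank) {t \<in> maxrank. gl_orbit t \<in> \<Union> K}" .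
    show "\<Union> K \<subseteq> gl_orbit ` maxrank"
      using K by auto
  qed
  then show ?thesis
    unfolding gr_topology_def by simp
qed

definition tz :: "nat list \<Rightarrow> 'r::finite zblock list \<Rightarrow> 'r tmat \<Rightarrow> nat \<Rightarrow> nat \<Rightarrow> 'r cmat" where
  "tz \<mu> z t j k = t ** (z ! (offs \<mu> j + k))"

definition X_set :: "nat list \<Rightarrow> 'r::finite zblock list \<Rightarrow> 'r tmat set set" where
  "X_set \<mu> z = {gl_orbit t | t. t \<in> maxrank \<and> (\<forall>j<length \<mu>. det (tz \<mu> z t j 0) \<noteq> 0)}"

definition X_top :: "nat list \<Rightarrow> 'r::finite zblock list \<Rightarrow> 'r tmat set topology" where
  "X_top \<mu> z = subtopology gr_topology (X_set \<mu> z)"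

definition Z_set :: "nat list \<Rightarrow> 'r::finite zblock list set" where
  "Z_set \<mu> = {z. length z = sum_list \<mu> \<and>
     (\<forall>i<length \<mu>. \<forall>j<length \<mu>. i \<noteq> j \<longrightarrow> det (hcat (z ! offs \<mu> i) (z ! offs \<mu> j)) \<noteq> 0) \<and>
     (\<forall>i<length \<mu>. 2 \<le> \<mu> ! i \<longrightarrow> det (hcat (z ! offs \<mu> i) (z ! (offs \<mu> i + 1))) \<noteq> 0)}"

text \<open>
  The affine coordinate \<open>u = t'\<^sup>-\<^sup>1 t''\<close> does not depend on the choice of the homogeneous
  coordinate \<open>t\<close>.
\<close>

definition affpt :: "'r::finite cmat \<Rightarrow> 'r tmat" where
  "affpt u = hcat (mat 1) u"

definition aff :: "'r::finite tmat set \<Rightarrow> 'r cmat" where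
  "aff p = (let t = (SOME t. t \<in> p) in matrix_inv (lpart t) ** rpart t)"


section \<open>Parametrised simplices and differential forms\<close>

text \<open>
  The standard simplex of dimension \<open>r\<^sup>2\<close> is parametrised by its barycentric coordinates
  \<open>1, \<dots>, r\<^sup>2\<close>, indexed by the pairs \<open>(i, j)\<close> in lexicographic order.
\<close>

definition rdim :: "'r itself \<Rightarrow> nat" where
  "rdim _ = CARD('r) * CARD('r)"

definition lexpairs :: "('r::{finite,wellorder} \<times> 'r) list" where
  "lexpairs = List.product (sorted_list_of_set UNIV) (sorted_list_of_set UNIV)"

definition bary :: "real^('r::{finite,wellorder} \<times> 'r) \<Rightarrow> nat \<Rightarrow> real" where
  "bary s n = (if n = 0 then 1 - (\<Sum>q\<in>UNIV. s $ q)
               else if n \<le> rdim TYPE('r) then s $ (lexpairs ! (n - 1)) else 0)"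

definition closed_spx :: "(real^('r::finite \<times> 'r)) set" where
  "closed_spx = {s. (\<forall>q. 0 \<le> s $ q) \<and> (\<Sum>q\<in>UNIV. s $ q) \<le> 1}"

definition open_spx :: "(real^('r::finite \<times> 'r)) set" where
  "open_spx = {s. (\<forall>q. 0 < s $ q) \<and> (\<Sum>q\<in>UNIV. s $ q) < 1}"

text \<open>
  The \<open>r\<^sup>2\<close>-form \<open>du\<close> evaluated at tangent vectors \<open>V q\<close> of \<open>Mat(r)\<close>.
\<close>

definition du_form :: "('r::finite \<times> 'r \<Rightarrow> 'r cmat) \<Rightarrow> complex" where
  "du_form V = det (\<chi> p q. V q $ fst p $ snd p :: complex^('r \<times> 'r)^('r \<times> 'r))"

definition hermitian :: "'r::finite cmat \<Rightarrow> bool" where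
  "hermitian U \<longleftrightarrow> (\<forall>i j. U $ i $ j = cnj (U $ j $ i))"

text \<open>
  Real coordinates of a Hermitian matrix: \<open>U\<^sub>i\<^sub>i\<close> sits at the index \<open>(i, i)\<close>, and for \<open>i < j\<close> the
  real and imaginary parts of \<open>U\<^sub>i\<^sub>j\<close> sit at \<open>(i, j)\<close> and \<open>(j, i)\<close>.  The form \<open>dU\<close> takes
  these coordinates in the same order as \<open>du\<close> takes the entries, which fixes its sign.
\<close>

definition hcoord :: "'r::{finite,wellorder} cmat \<Rightarrow> real^('r \<times> 'r)" where
  "hcoord U = (\<chi> p. if fst p \<le> snd p then Re (U $ fst p $ snd p) else Im (U $ snd p $ fst p))"

definition hmat :: "real^('r::{finite,wellorder} \<times> 'r) \<Rightarrow> 'r cmat" where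
  "hmat v = (\<chi> i j. if i = j then of_real (v $ (i, i))
                    else if i < j then Complex (v $ (i, j)) (v $ (j, i))
                    else Complex (v $ (j, i)) (- (v $ (i, j))))"

definition dU_form :: "('r::{finite,wellorder} \<times> 'r \<Rightarrow> 'r cmat) \<Rightarrow> real" where
  "dU_form V = det (\<chi> p q. hcoord (V q) $ p :: real^('r \<times> 'r)^('r \<times> 'r))"

definition herm_integrable :: "'r::{finite,wellorder} cmat set \<Rightarrow> ('r cmat \<Rightarrow> complex) \<Rightarrow> bool" where
  "herm_integrable D f \<longleftrightarrow> set_integrable lborel {v. hmat v \<in> D} (\<lambda>v. f (hmat v))"

definition herm_integral :: "'r::{finite,wellorder} cmat set \<Rightarrow> ('r cmat \<Rightarrow> complex) \<Rightarrow> complex" where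
  "herm_integral D f = set_lebesgue_integral lborel {v. hmat v \<in> D} (\<lambda>v. f (hmat v))"

definition posdef :: "'r::finite cmat \<Rightarrow> bool" where
  "posdef U \<longleftrightarrow> hermitian U \<and> (\<forall>v. v \<noteq> 0 \<longrightarrow> 0 < Re (\<Sum>i\<in>UNIV. cnj (v $ i) * (U *v v) $ i))"

definition unit_domain :: "'r::finite cmat set" where
  "unit_domain = {U. posdef U \<and> posdef (mat 1 - U)}"

definition Gamma_r :: "'r::{finite,wellorder} itself \<Rightarrow> complex \<Rightarrow> complex" where
  "Gamma_r _ a = herm_integral {U :: 'r cmat. posdef U}
     (\<lambda>U. etr (- U) * det U powr (a - of_nat CARD('r)))"


section \<open>Twisted chains\<close>

text \<open>
  A chain with coefficients in \<open>\<L>\<^sub>z\<close> assigns to every singular simplex \<open>\<sigma>\<close> of \<open>X\<^sub>z\<close> a section of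
  \<open>\<L>\<^sub>z\<close> along \<open>\<sigma>\<close>, i.e. a constant multiple of a branch of \<open>\<chi>(tz) \<tau>(t)\<close>.  The section is
  written as a function of \<open>s\<close> in the standard simplex and of a homogeneous coordinate \<open>t\<close> of
  \<open>\<sigma> s\<close> (the factor \<open>\<tau>(t)\<close> is omitted, which is why the function has weight \<open>- 2r\<close> in \<open>t\<close>),
  extended by zero.
\<close>

type_synonym 'r spx = "(nat \<Rightarrow> real) \<Rightarrow> 'r tmat set"
type_synonym 'r tchain = "'r spx \<Rightarrow> (nat \<Rightarrow> real) \<Rightarrow> 'r tmat \<Rightarrow> complex"

definition csupp :: "'r::finite tchain \<Rightarrow> 'r spx set" where
  "csupp C = {\<sigma>. C \<sigma> \<noteq> (\<lambda>s t. 0)}"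

definition is_section ::
  "nat list \<Rightarrow> complex list \<Rightarrow> 'r::finite zblock list \<Rightarrow> 'r spx \<Rightarrow> ((nat \<Rightarrow> real) \<Rightarrow> 'r tmat \<Rightarrow> complex) \<Rightarrow> bool" where
  "is_section \<mu> \<alpha> z \<sigma> \<phi> \<longleftrightarrow>
     (let E = {(s, t). s \<in> standard_simplex (rdim TYPE('r)) \<and> t \<in> \<sigma> s} in
      \<exists>c \<beta>. continuous_on E (\<lambda>(s, t). \<beta> s t) \<and>
        (\<forall>(s, t)\<in>E. \<beta> s t \<in> chi_values \<mu> \<alpha> (tz \<mu> z t)) \<and>
        (\<forall>(s, t)\<in>E. \<forall>g. invertible g \<longrightarrow> det g ^ (2 * CARD('r)) * \<beta> s (g ** t) = \<beta> s t) \<and>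
        (\<forall>s t. \<phi> s t = (if (s, t) \<in> E then c * \<beta> s t else 0)))"

definition C1_spx :: "'r::{finite,wellorder} spx \<Rightarrow> bool" where
  "C1_spx \<sigma> \<longleftrightarrow>
     (\<exists>(T :: real^('r \<times> 'r) \<Rightarrow> 'r tmat) T' W. open W \<and> closed_spx \<subseteq> W \<and>
        (\<forall>s\<in>W. (T has_derivative T' s) (at s)) \<and>
        (\<forall>v. continuous_on W (\<lambda>s. T' s v)) \<and>
        (\<forall>s\<in>closed_spx. T s \<in> \<sigma> (bary s)))"

definition twisted_chain ::
  "nat list \<Rightarrow> complex list \<Rightarrow> 'r::{finite,wellorder} zblock list \<Rightarrow> 'r tchain \<Rightarrow> bool" where
  "twisted_chain \<mu> \<alpha> z C \<longleftrightarrow>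
     (\<forall>\<sigma>\<in>csupp C. singular_simplex (rdim TYPE('r)) (X_top \<mu> z) \<sigma> \<and> C1_spx \<sigma> \<and>
        is_section \<mu> \<alpha> z \<sigma> (C \<sigma>)) \<and>
     (\<forall>p\<in>X_set \<mu> z. \<exists>W. openin (X_top \<mu> z) W \<and> p \<in> W \<and>
        finite {\<sigma> \<in> csupp C. \<sigma> ` standard_simplex (rdim TYPE('r)) \<inter> W \<noteq> {}})"

definition support_family ::
  "nat list \<Rightarrow> complex list \<Rightarrow> 'r::finite zblock list \<Rightarrow> 'r tmat set set set" where
  "support_family \<mu> \<alpha> z = {A. closedin (X_top \<mu> z) A \<and>
     (\<mu> \<noteq> [1, 1, 1, 1] \<longrightarrow>
       (\<forall>a. compactin (X_top \<mu> z) {p \<in> A. \<forall>t\<in>p. a \<le> Re (expo \<mu> \<alpha> (tz \<mu> z t))}))}"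

text \<open>
  Local finiteness makes the set of pairs \<open>(\<sigma>, k)\<close> with a given face \<open>\<rho>\<close> finite.
\<close>

definition twisted_cycle ::
  "nat list \<Rightarrow> complex list \<Rightarrow> 'r::{finite,wellorder} zblock list \<Rightarrow> 'r tchain \<Rightarrow> bool" where
  "twisted_cycle \<mu> \<alpha> z C \<longleftrightarrow>
     twisted_chain \<mu> \<alpha> z C \<and>
     (\<Union>\<sigma>\<in>csupp C. \<sigma> ` standard_simplex (rdim TYPE('r))) \<in> support_family \<mu> \<alpha> z \<and>
     (\<forall>\<rho> s t. singular_simplex (rdim TYPE('r) - 1) (X_top \<mu> z) \<rho> \<longrightarrow>
        s \<in> standard_simplex (rdim TYPE('r) - 1) \<longrightarrow> t \<in> \<rho> s \<longrightarrow>
        (\<Sum>(\<sigma>, k)\<in>{(\<sigma>, k). \<sigma> \<in> csupp C \<and> k \<le> rdim TYPE('r) \<and>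
                            singular_face (rdim TYPE('r)) k \<sigma> = \<rho>}.
           (- 1) ^ k * C \<sigma> (simplical_face k s) t) = 0)"


section \<open>Integrals over twisted chains\<close>

definition spx_u :: "'r::{finite,wellorder} spx \<Rightarrow> real^('r \<times> 'r) \<Rightarrow> 'r cmat" where
  "spx_u \<sigma> s = aff (\<sigma> (bary s))"

definition spx_tangent :: "'r::{finite,wellorder} spx \<Rightarrow> real^('r \<times> 'r) \<Rightarrow> 'r \<times> 'r \<Rightarrow> 'r cmat" where
  "spx_tangent \<sigma> s q = frechet_derivative (spx_u \<sigma>) (at s) (axis q 1)"

text \<open>
  The Radon hypergeometric function: the integral of \<open>\<chi>\<^sub>\<mu>(tz; \<alpha>) \<tau>(t)\<close> with
  \<open>\<tau>(t) = (det t')^(2r) du\<close>, where the branch of \<open>\<chi>\<^sub>\<mu>(tz; \<alpha>)\<close> on each simplex, times its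
  coefficient, is what \<open>C\<close> carries.  The integrand does not depend on the representative \<open>t\<close>.
  It is zero where \<open>det t' = 0\<close>: that locus has complex codimension one, so it does not
  contribute to the integral of a holomorphic form of top degree.
\<close>

definition radon_hgf ::
  "nat list \<Rightarrow> 'r::{finite,wellorder} zblock list \<Rightarrow> complex list \<Rightarrow> 'r tchain \<Rightarrow> complex" where
  "radon_hgf \<mu> z \<alpha> C =
     (if twisted_chain \<mu> \<alpha> z C then
        (\<Sum>\<^sub>\<infinity>\<sigma>\<in>csupp C. set_lebesgue_integral lborel open_spx
           (\<lambda>s. let t = (SOME t. t \<in> \<sigma> (bary s)) in
                C \<sigma> (bary s) t * det (lpart t) ^ (2 * CARD('r)) * du_form (spx_tangent \<sigma> s)))
      else undefined)"

text \<open>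
  \<open>carries I C\<close>: all simplices of \<open>C\<close> lie in the affine chart and, in the coordinate \<open>u\<close>, the
  coefficients of \<open>C\<close> are constant multiples of branches of the multivalued function \<open>I\<close>, which
  is given by its sets of values.  \<open>has_du_integral\<close> is the integral of \<open>I(u) du\<close> over \<open>C\<close>, with
  these branches; \<open>has_dU_integral\<close> is the same for \<open>dU\<close> and \<open>C\<close> in the Hermitian matrices.
\<close>

definition carries :: "('r::finite cmat \<Rightarrow> complex set) \<Rightarrow> 'r tchain \<Rightarrow> bool" where
  "carries I C \<longleftrightarrow>
     (\<forall>\<sigma>\<in>csupp C.
        (\<forall>s\<in>standard_simplex (rdim TYPE('r)). \<exists>u. \<sigma> s = gl_orbit (affpt u)) \<and>
        (\<exists>c \<beta>. continuous_on (standard_simplex (rdim TYPE('r))) \<beta> \<and>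
           (\<forall>s\<in>standard_simplex (rdim TYPE('r)).
              \<beta> s \<in> I (aff (\<sigma> s)) \<and> C \<sigma> s (affpt (aff (\<sigma> s))) = c * \<beta> s)))"

definition has_du_integral ::
  "('r::{finite,wellorder} cmat \<Rightarrow> complex set) \<Rightarrow> 'r tchain \<Rightarrow> complex \<Rightarrow> bool" where
  "has_du_integral I C y \<longleftrightarrow> carries I C \<and>
     y = (\<Sum>\<^sub>\<infinity>\<sigma>\<in>csupp C. set_lebesgue_integral lborel open_spx
            (\<lambda>s. C \<sigma> (bary s) (affpt (spx_u \<sigma> s)) * du_form (spx_tangent \<sigma> s)))"

definition in_hermitian :: "'r::finite tchain \<Rightarrow> bool" where
  "in_hermitian C \<longleftrightarrow>
     (\<forall>\<sigma>\<in>csupp C. \<forall>s\<in>standard_simplex (rdim TYPE('r)).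
        \<exists>U. hermitian U \<and> \<sigma> s = gl_orbit (affpt U))"

definition has_dU_integral ::
  "('r::{finite,wellorder} cmat \<Rightarrow> complex set) \<Rightarrow> 'r tchain \<Rightarrow> complex \<Rightarrow> bool" where
  "has_dU_integral I C y \<longleftrightarrow> carries I C \<and> in_hermitian C \<and>
     y = (\<Sum>\<^sub>\<infinity>\<sigma>\<in>csupp C. set_lebesgue_integral lborel open_spx
            (\<lambda>s. C \<sigma> (bary s) (affpt (spx_u \<sigma> s)) * of_real (dU_form (spx_tangent \<sigma> s))))"

text \<open>
  \<open>C\<close> is a decomposition of the positively oriented open set \<open>D\<close> of Hermitian matrices into
  non-overlapping simplices, and carries the single-valued branch \<open>f\<close> of the integrand with
  coefficient one.
\<close>

definition is_domain_chain ::
  "'r::{finite,wellorder} tchain \<Rightarrow> 'r cmat set \<Rightarrow> ('r cmat \<Rightarrow> complex) \<Rightarrow> bool" where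
  "is_domain_chain C D f \<longleftrightarrow>
     (\<forall>\<sigma>\<in>csupp C. inj_on (spx_u \<sigma>) open_spx \<and>
        (\<forall>s\<in>open_spx. 0 < dU_form (spx_tangent \<sigma> s)) \<and>
        (\<forall>s\<in>closed_spx. C \<sigma> (bary s) (affpt (spx_u \<sigma> s)) = f (spx_u \<sigma> s))) \<and>
     pairwise (\<lambda>\<sigma> \<sigma>'. disjnt (spx_u \<sigma> ` open_spx) (spx_u \<sigma>' ` open_spx)) (csupp C) \<and>
     (\<Union>\<sigma>\<in>csupp C. spx_u \<sigma> ` closed_spx) = D"


section \<open>The five normal forms\<close>

text \<open>
  For \<open>\<mu> = [4]\<close> the coefficient of \<open>w\<^sup>3\<close> in \<open>log (1 + u w + u x w\<^sup>3)\<close> is \<open>u x + u\<^sup>3/3\<close>.  Hence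
  \<open>tr (U X - U\<^sup>3/3)\<close>, the exponent of the Hermitian Airy integral, arises at \<open>x = - X\<close> with the
  last parameter \<open>- 1\<close>.
\<close>

definition x_mat :: "nat list \<Rightarrow> 'r::finite cmat \<Rightarrow> 'r zblock list" where
  "x_mat \<mu> x =
    (if \<mu> = [1, 1, 1, 1] then [vcat (mat 1) 0, vcat 0 (mat 1), vcat (mat 1) (- mat 1), vcat (mat 1) (- x)]
     else if \<mu> = [2, 1, 1] then [vcat (mat 1) 0, vcat 0 x, vcat 0 (mat 1), vcat (mat 1) (- mat 1)]
     else if \<mu> = [2, 2] then [vcat (mat 1) 0, vcat 0 x, vcat 0 (mat 1), vcat (mat 1) 0]
     else if \<mu> = [3, 1] then [vcat (mat 1) 0, vcat 0 (mat 1), vcat 0 x, vcat 0 (mat 1)]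
     else if \<mu> = [4] then [vcat (mat 1) 0, vcat 0 (mat 1), vcat 0 0, vcat 0 x]
     else undefined)"

definition admissible :: "nat list \<Rightarrow> complex list \<Rightarrow> 'r::finite cmat \<Rightarrow> bool" where
  "admissible \<mu> \<alpha> x \<longleftrightarrow> alpha_ok \<mu> CARD('r) \<alpha> \<and> x_mat \<mu> x \<in> Z_set \<mu>"

definition gauss_integrand :: "complex \<Rightarrow> complex \<Rightarrow> complex \<Rightarrow> 'r::finite cmat \<Rightarrow> 'r cmat \<Rightarrow> complex" where
  "gauss_integrand a b c X U =
     det U powr (a - of_nat CARD('r)) * det (mat 1 - U) powr (c - a - of_nat CARD('r)) *
     det (mat 1 - U ** X) powr (- b)"

definition hermitian_gauss :: "complex \<Rightarrow> complex \<Rightarrow> complex \<Rightarrow> 'r::{finite,wellorder} cmat \<Rightarrow> complex" where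
  "hermitian_gauss a b c X =
     Gamma_r TYPE('r) c / (Gamma_r TYPE('r) a * Gamma_r TYPE('r) (c - a)) *
     herm_integral unit_domain (gauss_integrand a b c X)"

end

(*
  On a simplex of the twisted chain, homogeneous coordinates factor as t = t' (1, u), so by
  equivariance the integrand is the value at (1, u).  There the determinants have continuous
  logarithms (the simplex is contractible), and the branch they define differs from the given
  section by a continuous factor with countably many values, hence by a constant.  The
  exponents are the coefficients of log (1 + u w + ...) for the five matrices.  On Hermitian
  matrices du is dU times the determinant of the matrix expressing entries through real
  coordinates.  The simplices of a decomposition of the Gauss domain have disjoint open images, so there are countably many of
  them, their boundaries are null sets, and the change of variables formula adds up.
*)
theory Submission
  imports Defs
begin

section \<open>Simplices\<close>

text \<open>The passage to u rests on the shape of the first column block, which is (1, 0)^T in all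
  five normal forms: the condition that it imposes on X_z reads det t' \<noteq> 0, so X_z lies in
  one affine chart and no simplex leaves it. Multivaluedness is harmless because two branches differ
  only by factors exp (2 pi \<i> n_j \<alpha>_j) with integers n_j. What shapes the Gauss part is
  measure theory. Integrals over simplices are taken with \<open>lborel\<close>, the change of
  variables with \<open>lebesgue\<close>. The two agree for Borel integrands, so the Jacobian has to
  be shown Borel measurable, which is done through difference quotients.\<close>

lemma lexpairs_props:
  "distinct (lexpairs :: ('r::{finite,wellorder} \<times> 'r) list)"
  "set (lexpairs :: ('r::{finite,wellorder} \<times> 'r) list) = UNIV"
  "length (lexpairs :: ('r::{finite,wellorder} \<times> 'r) list) = rdim TYPE('r)"
  unfolding lexpairs_def rdim_def
  by (auto simp: distinct_product)

lemma bij_betw_lexpairs: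
  "bij_betw (\<lambda>n. lexpairs ! (n - 1)) {1..rdim TYPE('r)} (UNIV :: ('r::{finite,wellorder} \<times> 'r) set)"
proof -
  have "bij_betw (\<lambda>n. n - 1) {1..rdim TYPE('r)} {..<rdim TYPE('r)}"
    by (rule bij_betw_byWitness [where f' = Suc]) auto
  moreover have "bij_betw ((!) lexpairs) {..<rdim TYPE('r)} (UNIV :: ('r \<times> 'r) set)"
    by (rule bij_betw_nth) (simp_all add: lexpairs_props)
  ultimately have "bij_betw ((!) lexpairs \<circ> (\<lambda>n. n - 1)) {1..rdim TYPE('r)} (UNIV :: ('r \<times> 'r) set)"
    by (rule bij_betw_trans)
  then show ?thesis
    by (simp add: o_def)
qed

text \<open>Counts from 1, because barycentric coordinate 0 is the complementary one, 1 minus the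
  sum of the others.\<close>

definition lexindex :: "'r::{finite,wellorder} \<times> 'r \<Rightarrow> nat" where
  "lexindex = inv_into {1..rdim TYPE('r)} (\<lambda>n. lexpairs ! (n - 1))"

lemma lexindex:
  "1 \<le> lexindex (q :: 'r::{finite,wellorder} \<times> 'r)" "lexindex q \<le> rdim TYPE('r)"
  "lexpairs ! (lexindex q - 1) = q"
proof -
  have "q \<in> (\<lambda>n. lexpairs ! (n - 1)) ` {1..rdim TYPE('r)}"
    using bij_betw_lexpairs unfolding bij_betw_def by blast
  from inv_into_into [OF this] f_inv_into_f [OF this]
  show "1 \<le> lexindex q" "lexindex q \<le> rdim TYPE('r)" "lexpairs ! (lexindex q - 1) = q"
    unfolding lexindex_def by auto
qed

lemma lexindex_nth:
  assumes "1 \<le> n" "n \<le> rdim TYPE('r)"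
  shows "lexindex (lexpairs ! (n - 1) :: 'r::{finite,wellorder} \<times> 'r) = n"
  unfolding lexindex_def
  by (rule inv_into_f_f) (use bij_betw_lexpairs assms in \<open>auto simp: bij_betw_def\<close>)

lemma closed_spxD:
  assumes "s \<in> closed_spx" shows "0 \<le> s $ q" "(\<Sum>q\<in>UNIV. s $ q) \<le> 1"
  using assms unfolding closed_spx_def by blast+

lemma open_spxD:
  assumes "s \<in> open_spx" shows "0 < s $ q" "(\<Sum>q\<in>UNIV. s $ q) < 1"
  using assms unfolding open_spx_def by blast+

text \<open>Inverse of \<open>bary\<close> on the standard simplex. The two maps link the simplex of
  singular homology, a set of functions on the naturals, to the solid simplex in
  \<open>real^('r \<times> 'r)\<close>, where calculus takes place.\<close>

definition unbary :: "(nat \<Rightarrow> real) \<Rightarrow> real^('r::{finite,wellorder} \<times> 'r)" where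
  "unbary x = (\<chi> q. x (lexindex q))"

lemma sum_lexpairs:
  "(\<Sum>n = 1..rdim TYPE('r). f (lexpairs ! (n - 1))) = (\<Sum>q\<in>(UNIV :: ('r::{finite,wellorder} \<times> 'r) set). f q)"
  by (rule sum.reindex_bij_betw [OF bij_betw_lexpairs])

lemma bary_in_standard_simplex:
  fixes s :: "real^('r::{finite,wellorder} \<times> 'r)"
  assumes "s \<in> closed_spx"
  shows "bary s \<in> standard_simplex (rdim TYPE('r))"
proof -
  note nn = closed_spxD(1) [OF assms] and le1 = closed_spxD(2) [OF assms]
  have le: "s $ q \<le> 1" for q
    using member_le_sum [of q UNIV "\<lambda>q. s $ q"] nn le1 by (simp add: order_trans)
  have "(\<Sum>i\<le>rdim TYPE('r). bary s i) = bary s 0 + (\<Sum>i=1..rdim TYPE('r). bary s i)"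
    by (simp add: atMost_atLeast0 sum.atLeast_Suc_atMost)
  also have "(\<Sum>i=1..rdim TYPE('r). bary s i) = (\<Sum>i=1..rdim TYPE('r). s $ (lexpairs ! (i - 1)))"
    by (intro sum.cong) (auto simp: bary_def)
  finally have "(\<Sum>i\<le>rdim TYPE('r). bary s i) = 1"
    using sum_lexpairs [of "\<lambda>q. s $ q"] by (simp add: bary_def)
  then show ?thesis
    using nn le le1 by (auto simp: standard_simplex_def bary_def sum_nonneg)
qed

lemma bary_unbary:
  assumes "x \<in> standard_simplex (rdim TYPE('r))"
  shows "bary (unbary x :: real^('r::{finite,wellorder} \<times> 'r)) = x"
    and "unbary x \<in> (closed_spx :: (real^('r \<times> 'r)) set)"
proof -
  have x: "\<And>i. 0 \<le> x i" "\<And>i. i > rdim TYPE('r) \<Longrightarrow> x i = 0" "(\<Sum>i\<le>rdim TYPE('r). x i) = 1"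
    using assms by (auto simp: standard_simplex_def)
  have "(\<Sum>q\<in>UNIV. x (lexindex (q :: 'r \<times> 'r))) = (\<Sum>i=1..rdim TYPE('r). x i)"
    unfolding sum_lexpairs [symmetric]
    by (intro sum.cong arg_cong [where f = x] lexindex_nth) auto
  moreover have "(\<Sum>i\<le>rdim TYPE('r). x i) = x 0 + (\<Sum>i=1..rdim TYPE('r). x i)"
    by (simp add: atMost_atLeast0 sum.atLeast_Suc_atMost)
  ultimately have *: "(\<Sum>q\<in>UNIV. x (lexindex (q :: 'r \<times> 'r))) = 1 - x 0"
    using x(3) by simp
  show "bary (unbary x :: real^('r::{finite,wellorder} \<times> 'r)) = x"
    using * x(2) lexindex_nth [where 'r = 'r] by (auto simp: bary_def unbary_def fun_eq_iff not_le)
  show "unbary x \<in> (closed_spx :: (real^('r \<times> 'r)) set)"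
    using * x(1) by (auto simp: closed_spx_def unbary_def)
qed

lemma continuous_on_bary: "continuous_on S (bary :: real^('r::{finite,wellorder} \<times> 'r) \<Rightarrow> _)"
proof (rule continuous_on_coordinatewise_then_product)
  fix i :: nat
  consider "i = 0" | "i > 0" "i \<le> rdim TYPE('r)" | "i > rdim TYPE('r)" by linarith
  then show "continuous_on S (\<lambda>s :: real^('r \<times> 'r). bary s i)"
    by cases (auto simp: bary_def intro!: continuous_intros)
qed

lemma continuous_on_unbary: "continuous_on S (unbary :: _ \<Rightarrow> real^('r::{finite,wellorder} \<times> 'r))"
  unfolding unbary_def
  by (intro continuous_intros continuous_on_product_coordinates[THEN continuous_on_subset]) auto

section \<open>Topology, convexity and null boundary of the simplex\<close>

lemma open_spx_subset: "open_spx \<subseteq> closed_spx"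
  by (auto simp: open_spx_def closed_spx_def less_imp_le)

lemma open_open_spx: "open (open_spx :: (real^('r::finite \<times> 'r)) set)"
proof -
  have "open_spx = (\<Inter>q. {s :: real^('r \<times> 'r). 0 < s $ q}) \<inter> {s. (\<Sum>q\<in>UNIV. s $ q) < 1}"
    unfolding open_spx_def by blast
  moreover have "open (\<Inter>q. {s :: real^('r \<times> 'r). 0 < s $ q})"
    by (intro open_INT) (auto intro!: open_Collect_less continuous_intros)
  moreover have "open {s :: real^('r \<times> 'r). (\<Sum>q\<in>UNIV. s $ q) < 1}"
    by (intro open_Collect_less continuous_intros)
  ultimately show ?thesis by (metis open_Int)
qed

lemma convex_closed_spx: "convex (closed_spx :: (real^('r::finite \<times> 'r)) set)"
proof (rule convexI)
  fix x y :: "real^('r::finite \<times> 'r)" and u v :: real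
  assume "x \<in> closed_spx" "y \<in> closed_spx" and uv: "0 \<le> u" "0 \<le> v" "u + v = 1"
  then have "u * (\<Sum>q\<in>UNIV. x $ q) + v * (\<Sum>q\<in>UNIV. y $ q) \<le> 1"
    by (intro convex_bound_le closed_spxD)
  then show "u *\<^sub>R x + v *\<^sub>R y \<in> closed_spx"
    using uv \<open>x \<in> closed_spx\<close> \<open>y \<in> closed_spx\<close>
    by (auto simp: closed_spx_def sum.distrib simp flip: sum_distrib_left)
qed

lemma open_spx_nonempty: "(open_spx :: (real^('r::finite \<times> 'r)) set) \<noteq> {}"
proof -
  \<comment> \<open>The barycentre: with d = r^2, all d + 1 barycentric coordinates equal 1 / (d +
    1).\<close>
  let ?c = "1 / (real CARD('r \<times> 'r) + 1)"
  have "(\<chi> q. ?c) \<in> (open_spx :: (real^('r \<times> 'r)) set)"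
    by (auto simp: open_spx_def field_simps add_pos_nonneg)
  then show ?thesis by blast
qed

text \<open>Moving a point a fraction 1 / (n + 1) of the way towards an interior point makes every
  coordinate positive and their sum smaller than 1.\<close>

lemma closed_spx_subset_closure: "closed_spx \<subseteq> closure (open_spx :: (real^('r::finite \<times> 'r)) set)"
proof
  fix x :: "real^('r \<times> 'r)" assume x: "x \<in> closed_spx"
  obtain c :: "real^('r \<times> 'r)" where c: "c \<in> open_spx"
    using open_spx_nonempty by blast
  have "x + (1 / real (Suc n)) *\<^sub>R (c - x) \<in> open_spx" for n
  proof -
    let ?t = "1 / real (Suc n)"
    have t: "0 < ?t" "?t \<le> 1" by auto
    have "0 < (1 - ?t) * x $ q + ?t * c $ q" for q
      using x c t by (intro add_nonneg_pos mult_nonneg_nonneg mult_pos_pos)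
        (auto intro: closed_spxD open_spxD)
    moreover have "(1 - ?t) * (\<Sum>q\<in>UNIV. x $ q) + ?t * (\<Sum>q\<in>UNIV. c $ q) < (1 - ?t) * 1 + ?t * 1"
      using x c t by (intro add_le_less_mono mult_left_mono mult_strict_left_mono)
        (auto intro: closed_spxD open_spxD)
    moreover have "(\<Sum>q\<in>UNIV. ((1 - ?t) *\<^sub>R x + ?t *\<^sub>R c) $ q)
        = (1 - ?t) * (\<Sum>q\<in>UNIV. x $ q) + ?t * (\<Sum>q\<in>UNIV. c $ q)"
      by (simp only: vector_add_component vector_scaleR_component sum.distrib sum_distrib_left real_scaleR_def)
    moreover have "x + ?t *\<^sub>R (c - x) = (1 - ?t) *\<^sub>R x + ?t *\<^sub>R c"
      by (simp add: algebra_simps)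
    ultimately show ?thesis
      unfolding open_spx_def by simp
  qed
  moreover have "(\<lambda>n. x + (1 / real (Suc n)) *\<^sub>R (c - x)) \<longlonglongrightarrow> x + 0 *\<^sub>R (c - x)"
    by (intro tendsto_intros LIMSEQ_Suc lim_1_over_n)
  ultimately show "x \<in> closure open_spx"
    unfolding closure_sequential by (intro exI [of _ "\<lambda>n. x + (1 / real (Suc n)) *\<^sub>R (c - x)"]) auto
qed

text \<open>The frontier of a convex set is null, and the faces lie in the frontier of the open
  simplex because that simplex is dense in the closed one.\<close>

lemma negligible_spx_boundary:
  "negligible (closed_spx - open_spx :: (real^('r::finite \<times> 'r)) set)"
proof (rule negligible_subset)
  have "convex (open_spx :: (real^('r \<times> 'r)) set)"
  proof (rule convexI)
    fix x y :: "real^('r \<times> 'r)" and u v :: real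
    assume xy: "x \<in> open_spx" "y \<in> open_spx" and uv: "0 \<le> u" "0 \<le> v" "u + v = 1"
    then have "u * (\<Sum>q\<in>UNIV. x $ q) + v * (\<Sum>q\<in>UNIV. y $ q) < 1"
      by (intro convex_bound_lt open_spxD)
    moreover have "0 < u * x $ q + v * y $ q" for q
      using convex_bound_lt [of "- x $ q" 0 "- y $ q" u v] uv
        open_spxD(1) [OF xy(1)] open_spxD(1) [OF xy(2)] by simp
    ultimately show "u *\<^sub>R x + v *\<^sub>R y \<in> open_spx"
      by (auto simp: open_spx_def sum.distrib simp flip: sum_distrib_left)
  qed
  then show "negligible (frontier (open_spx :: (real^('r \<times> 'r)) set))"
    by (rule negligible_convex_frontier)
  show "closed_spx - open_spx \<subseteq> frontier (open_spx :: (real^('r \<times> 'r)) set)"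
    using closed_spx_subset_closure interior_open [OF open_open_spx [where 'r = 'r]] by (auto simp: frontier_def)
qed

section \<open>Block matrices and the affine chart\<close>

lemma sum_UNIV_Plus: "(\<Sum>k\<in>(UNIV :: ('a::finite + 'b::finite) set). f k) = (\<Sum>a\<in>UNIV. f (Inl a)) + (\<Sum>b\<in>UNIV. f (Inr b))"
  unfolding UNIV_Plus_UNIV [symmetric] by (subst sum.Plus) auto

lemma hcat_mult_vcat: "hcat A B ** vcat P Q = A ** P + B ** Q"
  by (simp add: vec_eq_iff matrix_matrix_mult_def hcat_def vcat_def sum_UNIV_Plus)

lemma mult_hcat: "(g :: 'a::semiring_1^'n^'m) ** hcat A B = hcat (g ** A) (g ** B)"
  by (auto simp: vec_eq_iff matrix_matrix_mult_def hcat_def split: sum.splits)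

lemma lpart_hcat [simp]: "lpart (hcat A B) = A" and rpart_hcat [simp]: "rpart (hcat A B) = B"
  by (simp_all add: vec_eq_iff lpart_def rpart_def hcat_def)

lemma hcat_parts [simp]: "hcat (lpart t) (rpart t) = t"
  by (auto simp: vec_eq_iff lpart_def rpart_def hcat_def split: sum.splits)

lemma matrix_inv_left: "det (A :: 'a::field^'n^'n) \<noteq> 0 \<Longrightarrow> matrix_inv A ** A = mat 1"
  and matrix_inv_right: "det A \<noteq> 0 \<Longrightarrow> A ** matrix_inv A = mat 1"
proof -
  assume "det A \<noteq> 0"
  then have "\<exists>A'. A ** A' = mat 1 \<and> A' ** A = mat 1"
    using invertible_det_nz [of A] by (simp add: invertible_def)
  then have "A ** matrix_inv A = mat 1 \<and> matrix_inv A ** A = mat 1"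
    unfolding matrix_inv_def by (rule someI_ex)
  then show "matrix_inv A ** A = mat 1" and "A ** matrix_inv A = mat 1" by auto
qed

lemma matrix_inv_mat_1 [simp]: "matrix_inv (mat 1 :: 'a::field^'n^'n) = mat 1"
  using matrix_inv_left [of "mat 1 :: 'a^'n^'n"] by simp

lemma affpt_split:
  assumes "det (lpart t) \<noteq> 0"
  shows "t = lpart t ** affpt (matrix_inv (lpart t) ** rpart t)"
  using assms unfolding affpt_def
  by (simp add: mult_hcat matrix_mul_assoc matrix_inv_right)

lemma gl_orbit_mult:
  assumes "invertible g"
  shows "gl_orbit (g ** t) = gl_orbit (t :: 'r::finite tmat)"
proof -
  obtain g' where g': "g ** g' = mat 1" "g' ** g = mat 1"
    using assms unfolding invertible_def by blast
  have "h ** t = (h ** g') ** (g ** t)" for h :: "'r cmat"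
    by (metis g'(2) matrix_mul_assoc matrix_mul_rid)
  moreover have "invertible (h ** g')" if "invertible h" for h :: "'r cmat"
    using that g' by (intro invertible_mult) (auto simp: invertible_def)
  moreover have "invertible (h ** g)" if "invertible h" for h :: "'r cmat"
    using that assms by (rule invertible_mult)
  ultimately show ?thesis
    unfolding gl_orbit_def using matrix_mul_assoc by (smt (verit, best) Collect_cong)
qed

lemma self_in_gl_orbit: "t \<in> gl_orbit t"
  unfolding gl_orbit_def by (auto intro!: exI [of _ "mat 1"] simp: invertible_def)

text \<open>\<open>aff\<close> picks a representative by \<open>SOME\<close>. Two representatives
  differ by an invertible left factor g, which cancels in (g t')^-1 (g t''), so any of them may be
  used.\<close>

lemma aff_eq:
  assumes "t \<in> p" "p = gl_orbit t0" "det (lpart t0) \<noteq> 0"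
  shows "aff p = matrix_inv (lpart t) ** rpart t" and "p = gl_orbit (affpt (aff p))"
    and "t = lpart t ** affpt (aff p)" and "det (lpart t) \<noteq> 0"
proof -
  let ?u = "matrix_inv (lpart t0) ** rpart t0"
  have p: "p = gl_orbit (affpt ?u)"
    using affpt_split [OF assms(3)] assms gl_orbit_mult invertible_det_nz by metis
  have u: "matrix_inv (lpart s) ** rpart s = ?u \<and> s = lpart s ** affpt ?u \<and> det (lpart s) \<noteq> 0" if "s \<in> p" for s
  proof -
    obtain g where g: "invertible g" "s = g ** affpt ?u"
      using \<open>s \<in> p\<close> p unfolding gl_orbit_def [of "affpt ?u"] by blast
    then show ?thesis
      by (simp add: affpt_def mult_hcat matrix_mul_assoc matrix_inv_left invertible_det_nz)
  qed
  have "(SOME t. t \<in> p) \<in> p"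
    using assms(1) by (rule someI)
  then have a: "aff p = ?u"
    using u unfolding aff_def Let_def by blast
  show "aff p = matrix_inv (lpart t) ** rpart t" and "p = gl_orbit (affpt (aff p))"
    and "t = lpart t ** affpt (aff p)" and "det (lpart t) \<noteq> 0"
    using u assms p a by auto
qed

lemma aff_gl_orbit_affpt [simp]: "aff (gl_orbit (affpt u)) = u"
  using aff_eq(1) [OF self_in_gl_orbit refl, of "affpt u"] by (simp add: affpt_def)

section \<open>Differentiability of matrix operations\<close>

lemma differentiable_on_bounded_linear:
  assumes "bounded_linear L" "f differentiable_on S"
  shows "(\<lambda>x. L (f x)) differentiable_on S"
  unfolding differentiable_on_def differentiable_def
proof
  fix x assume "x \<in> S"
  then obtain D where "(f has_derivative D) (at x within S)"
    using assms(2) unfolding differentiable_on_def differentiable_def by blast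
  from bounded_linear.has_derivative [OF assms(1) this]
  show "\<exists>D. ((\<lambda>x. L (f x)) has_derivative D) (at x within S)" by blast
qed

lemma differentiable_on_sum:
  fixes f :: "'i \<Rightarrow> 'a::real_normed_vector \<Rightarrow> 'b::real_normed_vector"
  assumes "\<And>i. i \<in> I \<Longrightarrow> f i differentiable_on S"
  shows "(\<lambda>x. \<Sum>i\<in>I. f i x) differentiable_on S"
  using assms by (induction I rule: infinite_finite_induct) (auto intro!: differentiable_on_add)

lemma differentiable_on_cong:
  assumes "f differentiable_on S" "\<And>x. x \<in> S \<Longrightarrow> g x = f x"
  shows "g differentiable_on S"
  using assms differentiable_transform_within [OF _ zero_less_one, of f _ S g]
  unfolding differentiable_on_def by simp

lemma differentiable_on_vec_nth:
  fixes f :: "'a::real_normed_vector \<Rightarrow> ('b::real_normed_vector)^'n"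
  shows "f differentiable_on S \<Longrightarrow> (\<lambda>x. f x $ i) differentiable_on S"
  by (rule differentiable_on_bounded_linear [OF bounded_linear_vec_nth])

lemma bounded_linear_axis: "bounded_linear (axis i :: 'b::euclidean_space \<Rightarrow> 'b^'n)"
  by (rule linear_conv_bounded_linear [THEN iffD1], rule linearI)
    (auto simp: vec_eq_iff axis_def)

lemma differentiable_on_vec:
  fixes f :: "'a::real_normed_vector \<Rightarrow> ('b::euclidean_space)^'n"
  assumes "\<And>i. (\<lambda>x. f x $ i) differentiable_on S"
  shows "f differentiable_on S"
proof -
  have "f = (\<lambda>x. \<Sum>i\<in>UNIV. axis i (f x $ i))"
    by (auto simp: fun_eq_iff vec_eq_iff axis_def if_distrib sum.delta' cong: if_cong)
  moreover have "(\<lambda>x. \<Sum>i\<in>UNIV. axis i (f x $ i)) differentiable_on S"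
    by (intro differentiable_on_sum differentiable_on_bounded_linear [OF bounded_linear_axis] assms)
  ultimately show ?thesis by simp
qed

lemma differentiable_on_matrix_mult:
  fixes f :: "'a::real_normed_vector \<Rightarrow> complex^'n^'m" and g :: "'a \<Rightarrow> complex^'k^'n"
  assumes "f differentiable_on S" "g differentiable_on S"
  shows "(\<lambda>x. f x ** g x) differentiable_on S"
  by (rule differentiable_on_vec, rule differentiable_on_vec)
    (auto simp: matrix_matrix_mult_def intro!: differentiable_on_sum differentiable_on_mult
      differentiable_on_vec_nth assms)

lemma differentiable_on_prod:
  fixes f :: "'i \<Rightarrow> 'a::real_normed_vector \<Rightarrow> complex"
  assumes "\<And>i. i \<in> I \<Longrightarrow> f i differentiable_on S"
  shows "(\<lambda>x. \<Prod>i\<in>I. f i x) differentiable_on S"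
  using assms by (induction I rule: infinite_finite_induct) (auto intro!: differentiable_on_mult)

lemma differentiable_on_det:
  fixes f :: "'a::real_normed_vector \<Rightarrow> complex^'n^'n"
  assumes "f differentiable_on S"
  shows "(\<lambda>x. det (f x)) differentiable_on S"
  unfolding det_def
  by (intro differentiable_on_sum differentiable_on_mult differentiable_on_prod
      differentiable_on_const differentiable_on_vec_nth assms)

text \<open>Cramer's rule writes the entries of the inverse as quotients of polynomials in the given
  entries. This is how \<open>matrix_inv\<close>, which is defined by a choice, becomes accessible
  to differentiation.\<close>

lemma matrix_inv_cramer:
  fixes A :: "complex^'n^'n"
  assumes "det A \<noteq> 0"
  shows "matrix_inv A $ i $ j = det (\<chi> k l. if l = i then axis j 1 $ k else A $ k $ l) / det A"
proof -
  have "A *v (matrix_inv A *v axis j 1) = axis j 1"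
    by (simp add: matrix_vector_mul_assoc matrix_inv_right assms)
  then have "matrix_inv A *v axis j 1 = (\<chi> i. det (\<chi> k l. if l = i then axis j 1 $ k else A $ k $ l) / det A)"
    using cramer [OF assms] by blast
  then have "(matrix_inv A *v axis j 1) $ i = det (\<chi> k l. if l = i then axis j 1 $ k else A $ k $ l) / det A"
    by simp
  then show ?thesis
    by (simp add: matrix_vector_mul_component cart_eq_inner_axis matrix_vector_mult_def axis_def
        if_distrib sum.delta' cong: if_cong)
qed

lemma differentiable_on_matrix_inv:
  fixes f :: "'a::real_normed_vector \<Rightarrow> complex^'n^'n"
  assumes f: "f differentiable_on S" and nz: "\<And>x. x \<in> S \<Longrightarrow> det (f x) \<noteq> 0"
  shows "(\<lambda>x. matrix_inv (f x)) differentiable_on S"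
proof (rule differentiable_on_vec, rule differentiable_on_vec)
  fix i j
  let ?N = "\<lambda>x. det (\<chi> k l. if l = i then axis j 1 $ k else f x $ k $ l)"
  have N: "?N differentiable_on S"
  proof (rule differentiable_on_det, rule differentiable_on_vec, rule differentiable_on_vec)
    fix k l
    show "(\<lambda>x. (\<chi> k l. if l = i then axis j 1 $ k else f x $ k $ l) $ k $ l) differentiable_on S"
      by (cases "l = i") (simp_all add: differentiable_on_vec_nth f)
  qed
  have "(\<lambda>x. ?N x * inverse (det (f x))) differentiable_on S"
    by (rule differentiable_on_mult [OF N differentiable_on_inverse [OF differentiable_on_det [OF f] nz]])
  then show "(\<lambda>x. matrix_inv (f x) $ i $ j) differentiable_on S"
    by (rule differentiable_on_cong) (simp add: matrix_inv_cramer nz divide_inverse)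
qed

lemma differentiable_on_trace:
  fixes f :: "'a::real_normed_vector \<Rightarrow> complex^'n^'n"
  shows "f differentiable_on S \<Longrightarrow> (\<lambda>x. trace (f x)) differentiable_on S"
  unfolding trace_def by (intro differentiable_on_sum differentiable_on_vec_nth)

section \<open>Differentiability of the exponent of the character\<close>

lemma differentiable_on_jmul:
  fixes f g :: "'a::real_normed_vector \<Rightarrow> nat \<Rightarrow> 'r::finite cmat"
  assumes "\<And>k. (\<lambda>x. f x k) differentiable_on S" "\<And>k. (\<lambda>x. g x k) differentiable_on S"
  shows "(\<lambda>x. jmul (f x) (g x) k) differentiable_on S"
  unfolding jmul_def by (intro differentiable_on_sum differentiable_on_matrix_mult assms)

lemma differentiable_on_jpow:
  fixes f :: "'a::real_normed_vector \<Rightarrow> nat \<Rightarrow> 'r::finite cmat"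
  assumes "\<And>k. (\<lambda>x. f x k) differentiable_on S"
  shows "(\<lambda>x. jpow (f x) n k) differentiable_on S"
  by (induction n arbitrary: k) (auto intro!: differentiable_on_jmul assms)

text \<open>The exponent is a polynomial in the coefficients of h and in the inverses of the leading
  coefficients, hence the condition on their determinants.\<close>

lemma differentiable_on_expo:
  fixes h :: "'a::real_normed_vector \<Rightarrow> nat \<Rightarrow> nat \<Rightarrow> 'r::finite cmat"
  assumes h: "\<And>j k. (\<lambda>x. h x j k) differentiable_on S"
    and nz: "\<And>x j. x \<in> S \<Longrightarrow> j < length \<mu> \<Longrightarrow> det (h x j 0) \<noteq> 0"
  shows "(\<lambda>x. expo \<mu> \<alpha> (h x)) differentiable_on S"
  unfolding expo_def jtheta_def junder_def
  by (intro differentiable_on_sum differentiable_on_mult differentiable_on_const differentiable_on_trace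
      differentiable_on_bounded_linear [where L = "scaleR _", OF bounded_linear_scaleR_right] differentiable_on_jpow differentiable_on_diff differentiable_on_matrix_mult
      differentiable_on_matrix_inv h nz) auto

section \<open>Twisted chains in the affine chart\<close>

lemma tz_mult: "tz \<mu> z (g ** t) j k = g ** tz \<mu> z t j k"
  by (simp add: tz_def matrix_mul_assoc)

lemma mult_vcat_1_0: "t ** vcat (mat 1) 0 = lpart t"
  using hcat_mult_vcat [of "lpart t" "rpart t" "mat 1" 0] by simp

lemma linear_lpart: "linear lpart" and linear_rpart: "linear rpart"
  by (auto intro!: linearI simp: lpart_def rpart_def vec_eq_iff)

lemma affpt_eq: "affpt u = hcat (mat 1) 0 + hcat 0 u"
  by (auto simp: affpt_def hcat_def vec_eq_iff split: sum.splits)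

lemma linear_hcat_right: "linear (hcat 0)"
  by (auto intro!: linearI simp: hcat_def vec_eq_iff split: sum.splits)

lemma linear_mult_right: "linear (\<lambda>t :: complex^'n^'m. t ** (A :: complex^'k^'n))"
  by (auto intro!: linearI simp: matrix_matrix_mult_def vec_eq_iff sum.distrib distrib_right scaleR_sum_right)

lemma differentiable_on_affpt:
  "f differentiable_on S \<Longrightarrow> (\<lambda>x. affpt (f x)) differentiable_on S"
  unfolding affpt_eq
  by (intro differentiable_on_add differentiable_on_const
      differentiable_on_bounded_linear [OF linear_conv_bounded_linear [THEN iffD1, OF linear_hcat_right]])

context
  fixes \<mu> :: "nat list" and \<alpha> :: "complex list" and z :: "'r::{finite,wellorder} zblock list"
    and C :: "'r tchain" and \<sigma> :: "'r spx"
  assumes chain: "twisted_chain \<mu> \<alpha> z C" and \<sigma>: "\<sigma> \<in> csupp C"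
    and \<mu>: "\<mu> \<noteq> []" and z0: "z ! 0 = vcat (mat 1) 0"
begin

text \<open>As block 0 of z is (1, 0)^T, t times it is t', and the condition for j = 0 in
  \<open>X_set\<close> places the simplex in the affine chart. The conditions for the other j pass
  from t to (1, u) because t = t' (1, u) with t' invertible.\<close>

lemma spx_affine:
  assumes s: "s \<in> standard_simplex (rdim TYPE('r))"
  shows "\<sigma> s = gl_orbit (affpt (aff (\<sigma> s)))"
    and "t \<in> \<sigma> s \<Longrightarrow> t = lpart t ** affpt (aff (\<sigma> s)) \<and> det (lpart t) \<noteq> 0 \<and>
           aff (\<sigma> s) = matrix_inv (lpart t) ** rpart t"
    and "j < length \<mu> \<Longrightarrow> det (tz \<mu> z (affpt (aff (\<sigma> s))) j 0) \<noteq> 0"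
proof -
  have "singular_simplex (rdim TYPE('r)) (X_top \<mu> z) \<sigma>"
    using chain \<sigma> by (auto simp: twisted_chain_def)
  then have "\<sigma> ` standard_simplex (rdim TYPE('r)) \<subseteq> topspace (X_top \<mu> z)"
    by (auto simp: singular_simplex_def continuous_map_def)
  then have "\<sigma> s \<in> X_set \<mu> z"
    using s by (auto simp: X_top_def topspace_subtopology)
  then obtain t0 where t0: "\<sigma> s = gl_orbit t0" "\<And>j. j < length \<mu> \<Longrightarrow> det (tz \<mu> z t0 j 0) \<noteq> 0"
    by (auto simp: X_set_def)
  have l0: "det (lpart t0) \<noteq> 0"
    using t0(2) [of 0] \<mu> by (simp add: tz_def offs_def z0 mult_vcat_1_0)
  note aff = aff_eq [OF _ t0(1) l0]
  have t0': "t0 \<in> \<sigma> s"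
    using self_in_gl_orbit t0(1) by blast
  show "\<sigma> s = gl_orbit (affpt (aff (\<sigma> s)))"
    using aff(2) [OF t0'] .
  show "t \<in> \<sigma> s \<Longrightarrow> t = lpart t ** affpt (aff (\<sigma> s)) \<and> det (lpart t) \<noteq> 0 \<and>
           aff (\<sigma> s) = matrix_inv (lpart t) ** rpart t"
    using aff by blast
  assume j: "j < length \<mu>"
  have "tz \<mu> z t0 j 0 = lpart t0 ** tz \<mu> z (affpt (aff (\<sigma> s))) j 0"
    using aff(3) [OF t0'] tz_mult by metis
  then show "det (tz \<mu> z (affpt (aff (\<sigma> s))) j 0) \<noteq> 0"
    using t0(2) [OF j] by (auto simp: det_mul)
qed

text \<open>The lift T in \<open>C1_spx\<close> gives differentiable homogeneous coordinates along
  the simplex, and u = T'^-1 T'' where T = (T', T'').\<close>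

lemma spx_u_differentiable: "spx_u \<sigma> differentiable_on closed_spx"
proof -
  have "C1_spx \<sigma>"
    using chain \<sigma> by (auto simp: twisted_chain_def)
  then obtain T :: "real^('r \<times> 'r) \<Rightarrow> 'r tmat" and T' W where W: "open W" "closed_spx \<subseteq> W"
    "\<And>s. s \<in> W \<Longrightarrow> (T has_derivative T' s) (at s)" and T: "\<And>s. s \<in> closed_spx \<Longrightarrow> T s \<in> \<sigma> (bary s)"
    unfolding C1_spx_def by blast
  have dT: "T differentiable_on closed_spx"
    using W unfolding differentiable_on_def differentiable_def by (meson has_derivative_at_withinI subsetD)
  have u: "spx_u \<sigma> s = matrix_inv (lpart (T s)) ** rpart (T s)" "det (lpart (T s)) \<noteq> 0"
    if "s \<in> closed_spx" for s
    using spx_affine(2) [OF bary_in_standard_simplex [OF that] T [OF that]] by (auto simp: spx_u_def)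
  have "(\<lambda>s. matrix_inv (lpart (T s)) ** rpart (T s)) differentiable_on closed_spx"
    by (intro differentiable_on_matrix_mult differentiable_on_matrix_inv u
        differentiable_on_bounded_linear [OF linear_conv_bounded_linear [THEN iffD1, OF linear_lpart] dT]
        differentiable_on_bounded_linear [OF linear_conv_bounded_linear [THEN iffD1, OF linear_rpart] dT])
  then show ?thesis
    using u(1) by (rule differentiable_on_cong)
qed

lemma spx_u_has_derivative:
  assumes "s \<in> open_spx"
  shows "(spx_u \<sigma> has_derivative frechet_derivative (spx_u \<sigma>) (at s)) (at s)"
proof -
  have "spx_u \<sigma> differentiable at s"
    using differentiable_on_subset [OF spx_u_differentiable open_spx_subset] assms
      differentiable_on_eq_differentiable_at [OF open_open_spx] by blast
  then show ?thesis
    by (simp add: frechet_derivative_works)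
qed

text \<open>Hermitian matrices are the common kernel of the real linear maps sending U to U_ij - cnj
  U_ji. Along the simplex these maps vanish on an open set, hence so do their derivatives.\<close>

lemma spx_tangent_hermitian:
  assumes herm: "\<And>s. s \<in> open_spx \<Longrightarrow> hermitian (spx_u \<sigma> s)" and s: "s \<in> open_spx"
  shows "hermitian (spx_tangent \<sigma> s q)"
proof -
  let ?D = "frechet_derivative (spx_u \<sigma>) (at s)"
  have "?D v $ i $ j - cnj (?D v $ j $ i) = 0" for v i j
  proof -
    let ?L = "\<lambda>U :: 'r cmat. U $ i $ j - cnj (U $ j $ i)"
    have "bounded_linear ?L"
      by (intro linear_conv_bounded_linear [THEN iffD1] linearI) (auto simp: algebra_simps)
    then have 1: "((\<lambda>s. ?L (spx_u \<sigma> s)) has_derivative (\<lambda>v. ?L (?D v))) (at s)"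
      using spx_u_has_derivative [OF s] by (rule bounded_linear.has_derivative)
    have "((\<lambda>s. ?L (spx_u \<sigma> s)) has_derivative (\<lambda>v. 0)) (at s)"
    proof (rule has_derivative_transform_within_open [OF has_derivative_const open_open_spx s])
      show "0 = ?L (spx_u \<sigma> x)" if "x \<in> open_spx" for x
        using herm [OF that] unfolding hermitian_def by (metis diff_self)
    qed
    from has_derivative_unique [OF 1 this] show ?thesis
      by metis
  qed
  then show ?thesis
    unfolding hermitian_def spx_tangent_def right_minus_eq by blast
qed

lemma tz_spx_differentiable:
  "(\<lambda>s. tz \<mu> z (affpt (spx_u \<sigma> s)) j k) differentiable_on closed_spx"
  unfolding tz_def
  by (rule differentiable_on_bounded_linear [OF linear_conv_bounded_linear [THEN iffD1, OF linear_mult_right]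
        differentiable_on_affpt [OF spx_u_differentiable]])

text \<open>The section has weight -2r in t and the factor (det t')^(2r) of \<tau> has weight 2r.
  Their product is therefore the same at the chosen t and at (1, u), where det t' = 1.\<close>

lemma radon_integrand:
  assumes s: "s \<in> open_spx"
  shows "(let t = (SOME t. t \<in> \<sigma> (bary s)) in C \<sigma> (bary s) t * det (lpart t) ^ (2 * CARD('r)) * V)
       = C \<sigma> (bary s) (affpt (spx_u \<sigma> s)) * V"
proof -
  have b: "bary s \<in> standard_simplex (rdim TYPE('r))"
    using s open_spx_subset bary_in_standard_simplex by blast
  define t where "t = (SOME t. t \<in> \<sigma> (bary s))"
  define u where "u = aff (\<sigma> (bary s))"
  have u: "affpt u \<in> \<sigma> (bary s)"
    using spx_affine(1) [OF b] self_in_gl_orbit unfolding u_def by metis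
  then have t: "t \<in> \<sigma> (bary s)"
    unfolding t_def by (rule someI)
  have tu: "lpart t ** affpt u = t" and l: "det (lpart t) \<noteq> 0"
    using spx_affine(2) [OF b t, folded u_def] by metis+
  define E where "E = {(s, t). s \<in> standard_simplex (rdim TYPE('r)) \<and> t \<in> \<sigma> s}"
  obtain c \<beta> where
    eqv: "\<forall>(s, t)\<in>E. \<forall>g. invertible g \<longrightarrow> det g ^ (2 * CARD('r)) * \<beta> s (g ** t) = \<beta> s t"
    and \<phi>: "\<forall>s t. C \<sigma> s t = (if (s, t) \<in> E then c * \<beta> s t else 0)"
  proof -
    have "is_section \<mu> \<alpha> z \<sigma> (C \<sigma>)"
      using chain \<sigma> by (auto simp: twisted_chain_def)
    then show thesis
      unfolding is_section_def Let_def E_def [symmetric] using that by blast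
  qed
  have E: "(bary s, t) \<in> E" "(bary s, affpt u) \<in> E"
    using b t u by (auto simp: E_def)
  have "invertible (lpart t)"
    using l by (simp add: invertible_det_nz)
  then have "det (lpart t) ^ (2 * CARD('r)) * \<beta> (bary s) (lpart t ** affpt u) = \<beta> (bary s) (affpt u)"
    using eqv E(2) by blast
  then have *: "det (lpart t) ^ (2 * CARD('r)) * \<beta> (bary s) t = \<beta> (bary s) (affpt u)"
    unfolding tu .
  have "C \<sigma> (bary s) t * det (lpart t) ^ (2 * CARD('r)) = c * \<beta> (bary s) (affpt u)"
    unfolding * [symmetric] using \<phi> E(1) by simp
  also have "\<dots> = C \<sigma> (bary s) (affpt u)"
    using \<phi> E(2) by simp
  finally show ?thesis
    unfolding Let_def t_def [symmetric] spx_u_def u_def [symmetric] by simp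
qed

end

section \<open>Branches of the character along a simplex\<close>

text \<open>The image is connected, and a connected subset of a metric space with two distinct
  points is uncountable.\<close>

lemma connected_countable_values_constant:
  fixes f :: "'a::topological_space \<Rightarrow> 'b::metric_space"
  assumes "continuous_on S f" "connected S" "countable R" "f ` S \<subseteq> R" "x \<in> S" "y \<in> S"
  shows "f x = f y"
proof (rule ccontr)
  assume "f x \<noteq> f y"
  with assms have "uncountable (f ` S)"
    by (intro connected_uncountable [of _ "f x" "f y"] connected_continuous_image) auto
  then show False
    using assms countable_subset by blast
qed

text \<open>Values of the character at (1, u) when z starts with the block (1, 0)^T. The product
  starts at j = 1: the determinant for j = 0 is then 1, and another logarithm of 1 contributes only
  a constant factor, which the coefficient in \<open>carries\<close> absorbs.\<close>

definition chart_values :: "nat list \<Rightarrow> complex list \<Rightarrow> 'r::finite zblock list \<Rightarrow> 'r cmat \<Rightarrow> complex set" where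
  "chart_values \<mu> \<alpha> z u =
     {(\<Prod>j=1..<length \<mu>. exp (\<alpha> ! offs \<mu> j * l j)) * exp (expo \<mu> \<alpha> (tz \<mu> z (affpt u))) | l.
        \<forall>j\<in>{1..<length \<mu>}. exp (l j) = det (tz \<mu> z (affpt u) j 0)}"

lemma carries_chart_values:
  fixes z :: "'r::{finite,wellorder} zblock list"
  assumes chain: "twisted_chain \<mu> \<alpha> z C" and \<mu>: "\<mu> \<noteq> []" and z0: "z ! 0 = vcat (mat 1) 0"
  shows "carries (chart_values \<mu> \<alpha> z) C"
  unfolding carries_def
proof (intro ballI conjI)
  fix \<sigma> s assume \<sigma>: "\<sigma> \<in> csupp C" and s: "s \<in> standard_simplex (rdim TYPE('r))"
  show "\<exists>u. \<sigma> s = gl_orbit (affpt u)"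
    using spx_affine(1) [OF chain \<sigma> \<mu> z0 s] by blast
next
  fix \<sigma> assume \<sigma>: "\<sigma> \<in> csupp C"
  let ?K = "closed_spx :: (real^('r \<times> 'r)) set"
  note aff = spx_affine [OF chain \<sigma> \<mu> z0]
  define h where "h v = tz \<mu> z (affpt (spx_u \<sigma> v))" for v
  have nz: "det (h v j 0) \<noteq> 0" if "v \<in> ?K" "j < length \<mu>" for v j
    using aff(3) [OF bary_in_standard_simplex [OF that(1)] that(2)] by (simp add: h_def spx_u_def)
  have dh: "(\<lambda>v. h v j k) differentiable_on ?K" for j k
    unfolding h_def by (rule tz_spx_differentiable [OF chain \<sigma> \<mu> z0])
  have "contractible ?K"
    by (intro convex_imp_contractible convex_closed_spx)
  have "\<exists>L. continuous_on ?K L \<and> (\<forall>v\<in>?K. exp (L v) = det (h v j 0))" if "j < length \<mu>" for j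
  proof -
    have "continuous_on ?K (\<lambda>v. det (h v j 0))"
      by (intro differentiable_imp_continuous_on differentiable_on_det dh)
    from continuous_logarithm_on_contractible [OF this \<open>contractible ?K\<close> nz [OF _ that]]
    show ?thesis by metis
  qed
  then obtain L0 where L0: "\<And>j. j < length \<mu> \<Longrightarrow> continuous_on ?K (L0 j)"
    "\<And>j v. j < length \<mu> \<Longrightarrow> v \<in> ?K \<Longrightarrow> exp (L0 j v) = det (h v j 0)"
    by metis
  \<comment> \<open>The determinant of block 0 is identically 1. Choosing 0 as its logarithm makes
    the reference branch \<gamma> a member of \<open>chart_values\<close>.\<close>
  define L where "L j v = (if j = 0 then 0 else L0 j v)" for j v
  have contL: "continuous_on ?K (L j)" if "j < length \<mu>" for j
    using L0(1) [OF that] by (cases "j = 0") (auto simp: L_def [abs_def])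
  have "h v 0 0 = mat 1" for v
    by (simp add: h_def tz_def offs_def z0 mult_vcat_1_0 affpt_def)
  then have expL: "exp (L j v) = det (h v j 0)" if "j < length \<mu>" "v \<in> ?K" for j v
    using L0(2) that by (simp add: L_def)
  define \<gamma> where "\<gamma> v = (\<Prod>j<length \<mu>. exp (\<alpha> ! offs \<mu> j * L j v)) * exp (expo \<mu> \<alpha> (h v))" for v
  have cont\<gamma>: "continuous_on ?K \<gamma>"
    unfolding \<gamma>_def
    by (intro continuous_intros contL differentiable_imp_continuous_on differentiable_on_expo dh nz) auto
  have \<gamma>nz: "\<gamma> v \<noteq> 0" for v
    by (simp add: \<gamma>_def)
  define E where "E = {(s, t). s \<in> standard_simplex (rdim TYPE('r)) \<and> t \<in> \<sigma> s}"
  obtain c \<beta> where cont: "continuous_on E (\<lambda>(s, t). \<beta> s t)"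
    and chi: "\<And>s t. (s, t) \<in> E \<Longrightarrow> \<beta> s t \<in> chi_values \<mu> \<alpha> (tz \<mu> z t)"
    and C: "\<And>s t. C \<sigma> s t = (if (s, t) \<in> E then c * \<beta> s t else 0)"
  proof -
    have "is_section \<mu> \<alpha> z \<sigma> (C \<sigma>)"
      using chain \<sigma> by (auto simp: twisted_chain_def)
    then show thesis
      unfolding is_section_def Let_def E_def [symmetric] using that by blast
  qed
  have inE: "(bary v, affpt (spx_u \<sigma> v)) \<in> E" if "v \<in> ?K" for v
    using aff(1) [OF bary_in_standard_simplex [OF that]] self_in_gl_orbit bary_in_standard_simplex [OF that]
    unfolding E_def spx_u_def by fastforce
  define b where "b v = \<beta> (bary v) (affpt (spx_u \<sigma> v))" for v
  have "continuous_on ?K (\<lambda>v. affpt (spx_u \<sigma> v))"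
    by (intro differentiable_imp_continuous_on differentiable_on_affpt spx_u_differentiable [OF chain \<sigma> \<mu> z0])
  then have "continuous_on ?K (\<lambda>v. (bary v, affpt (spx_u \<sigma> v)))"
    by (intro continuous_on_Pair continuous_on_bary)
  from continuous_on_compose2 [OF cont this] inE
  have contb: "continuous_on ?K b"
    by (auto simp: b_def [abs_def])
  \<comment> \<open>Two logarithms of the same determinant differ by 2 pi \<i> n_j, so every
    quotient of two branches lies in R. Integer lists as indices make R countable.\<close>
  define R where "R = range (\<lambda>ks :: int list. \<Prod>j<length \<mu>. exp (\<alpha> ! offs \<mu> j * (of_int (2 * ks ! j) * of_real pi * \<i>)))"
  have "b v / \<gamma> v \<in> R" if v: "v \<in> ?K" for v
  proof -
    obtain l where l: "\<And>j. j < length \<mu> \<Longrightarrow> exp (l j) = det (h v j 0)" and bl: "b v = chi \<mu> \<alpha> (h v) l"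
      using chi [OF inE [OF v]] unfolding chi_values_def b_def h_def by blast
    have "\<exists>n :: int. l j = L j v + of_int (2 * n) * of_real pi * \<i>" if "j < length \<mu>" for j
      using l [OF that] expL [OF that v] exp_eq [of "l j" "L j v"] by simp
    then obtain n :: "nat \<Rightarrow> int" where n: "\<And>j. j < length \<mu> \<Longrightarrow> l j = L j v + of_int (2 * n j) * of_real pi * \<i>"
      by metis
    have "b v = \<gamma> v * (\<Prod>j<length \<mu>. exp (\<alpha> ! offs \<mu> j * (of_int (2 * n j) * of_real pi * \<i>)))"
    proof -
      have "(\<Prod>j<length \<mu>. exp (\<alpha> ! offs \<mu> j * l j)) =
         (\<Prod>j<length \<mu>. exp (\<alpha> ! offs \<mu> j * L j v) * exp (\<alpha> ! offs \<mu> j * (of_int (2 * n j) * of_real pi * \<i>)))"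
        by (intro prod.cong refl) (simp add: n distrib_left exp_add)
      then show ?thesis
        by (simp add: bl chi_def \<gamma>_def prod.distrib mult_ac)
    qed
    then have "b v / \<gamma> v = (\<Prod>j<length \<mu>. exp (\<alpha> ! offs \<mu> j * (of_int (2 * map n [0..<length \<mu>] ! j) * of_real pi * \<i>)))"
      using \<gamma>nz [of v] by simp
    then show ?thesis
      unfolding R_def by blast
  qed
  then have "(\<lambda>v. b v / \<gamma> v) ` ?K \<subseteq> R" by blast
  moreover have "countable R"
    unfolding R_def by blast
  moreover have "continuous_on ?K (\<lambda>v. b v / \<gamma> v)"
    using \<gamma>nz by (intro continuous_on_divide contb cont\<gamma>) auto
  moreover have "connected ?K"
    by (intro convex_connected convex_closed_spx)
  ultimately have const: "b v / \<gamma> v = b w / \<gamma> w" if "v \<in> ?K" "w \<in> ?K" for v w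
    using connected_countable_values_constant that by (metis (no_types, lifting))
  obtain w where w: "w \<in> ?K"
    using open_spx_nonempty open_spx_subset by blast
  define k where "k = b w / \<gamma> w"
  have bk: "b v = k * \<gamma> v" if "v \<in> ?K" for v
    using const [OF that w] \<gamma>nz [of v] by (simp add: k_def field_simps)
  show "\<exists>c \<beta>. continuous_on (standard_simplex (rdim TYPE('r))) \<beta> \<and>
           (\<forall>s\<in>standard_simplex (rdim TYPE('r)).
              \<beta> s \<in> chart_values \<mu> \<alpha> z (aff (\<sigma> s)) \<and> C \<sigma> s (affpt (aff (\<sigma> s))) = c * \<beta> s)"
  \<comment> \<open>Here c is the coefficient of the given section and k the constant ratio of its
    branch to \<gamma>; \<open>unbary\<close> transports \<gamma> to barycentric
    coordinates.\<close>
  proof (intro exI [of _ "c * k"] exI [of _ "\<lambda>s. \<gamma> (unbary s)"] conjI ballI)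
    show "continuous_on (standard_simplex (rdim TYPE('r))) (\<lambda>s. \<gamma> (unbary s))"
      by (rule continuous_on_compose2 [OF cont\<gamma> continuous_on_unbary]) (auto simp: bary_unbary)
    fix s assume s: "s \<in> standard_simplex (rdim TYPE('r))"
    define v :: "real^('r \<times> 'r)" where "v = unbary s"
    have v: "v \<in> ?K" "bary v = s"
      using bary_unbary [OF s] by (auto simp: v_def)
    have u: "aff (\<sigma> s) = spx_u \<sigma> v"
      by (simp add: spx_u_def v)
    have "{..<length \<mu>} = insert 0 {1..<length \<mu>}"
      using \<mu> by auto
    then have "\<gamma> v = (\<Prod>j=1..<length \<mu>. exp (\<alpha> ! offs \<mu> j * L j v)) * exp (expo \<mu> \<alpha> (h v))"
      by (simp add: \<gamma>_def L_def)
    then show "\<gamma> (unbary s) \<in> chart_values \<mu> \<alpha> z (aff (\<sigma> s))"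
      unfolding chart_values_def v_def [symmetric] u h_def [symmetric]
      using expL v(1) by (intro CollectI exI [of _ "\<lambda>j. L j v"]) auto
    show "C \<sigma> s (affpt (aff (\<sigma> s))) = c * k * \<gamma> (unbary s)"
      using C [of s] inE [OF v(1)] bk [OF v(1)] unfolding v u v_def [symmetric]
      by (simp add: b_def v(2))
  qed
qed

text \<open>\<open>carries\<close> asks only for membership in the value sets, so for each normal
  form an inclusion of value sets suffices.\<close>

lemma carries_mono: "carries I C \<Longrightarrow> (\<And>u. I u \<subseteq> J u) \<Longrightarrow> carries J C"
  unfolding carries_def by (meson subsetD)

section \<open>Integrals in the affine chart\<close>

lemma radon_hgf_chart:
  fixes z :: "'r::{finite,wellorder} zblock list"
  assumes chain: "twisted_chain \<mu> \<alpha> z C" and \<mu>: "\<mu> \<noteq> []" and z0: "z ! 0 = vcat (mat 1) 0"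
  shows "radon_hgf \<mu> z \<alpha> C = (\<Sum>\<^sub>\<infinity>\<sigma>\<in>csupp C. set_lebesgue_integral lborel open_spx
            (\<lambda>s. C \<sigma> (bary s) (affpt (spx_u \<sigma> s)) * du_form (spx_tangent \<sigma> s)))"
proof -
  have eq: "indicator open_spx s *\<^sub>R (let t = (SOME t. t \<in> \<sigma> (bary s)) in
              C \<sigma> (bary s) t * det (lpart t) ^ (2 * CARD('r)) * du_form (spx_tangent \<sigma> s))
      = indicator open_spx s *\<^sub>R (C \<sigma> (bary s) (affpt (spx_u \<sigma> s)) * du_form (spx_tangent \<sigma> s))"
    if "\<sigma> \<in> csupp C" for \<sigma> s
    using radon_integrand [OF chain that \<mu> z0, of s] by (cases "s \<in> open_spx") auto
  show ?thesis
    unfolding radon_hgf_def set_lebesgue_integral_def if_P [OF chain]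
    by (intro infsum_cong Bochner_Integration.integral_cong refl eq)
qed

lemma has_du_integral_radon_hgf:
  fixes z :: "'r::{finite,wellorder} zblock list"
  assumes "twisted_chain \<mu> \<alpha> z C" "\<mu> \<noteq> []" "z ! 0 = vcat (mat 1) 0"
    and "\<And>u. chart_values \<mu> \<alpha> z u \<subseteq> I u"
  shows "has_du_integral I C (radon_hgf \<mu> z \<alpha> C)"
  unfolding has_du_integral_def
  using radon_hgf_chart [OF assms(1-3)] carries_mono [OF carries_chart_values [OF assms(1-3)]] assms(4)
  by blast

lemma in_hermitian_spx_u:
  assumes "in_hermitian C" "\<sigma> \<in> csupp C" "s \<in> closed_spx"
  shows "hermitian (spx_u \<sigma> s)"
proof -
  obtain U where "hermitian U" "\<sigma> (bary s) = gl_orbit (affpt U)"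
    using assms bary_in_standard_simplex unfolding in_hermitian_def by blast
  then show ?thesis
    by (simp add: spx_u_def)
qed

text \<open>Tangent vectors of a simplex of Hermitian matrices are Hermitian, so du = \<kappa> dU
  applies to them. The factor \<kappa> leaves the integral and the infinite sum without a
  convergence hypothesis, because a divergent integral or sum has the value 0 on both sides.\<close>

lemma has_dU_integral_radon_hgf:
  fixes z :: "'r::{finite,wellorder} zblock list"
  assumes chain: "twisted_chain \<mu> \<alpha> z C" and \<mu>: "\<mu> \<noteq> []" and z0: "z ! 0 = vcat (mat 1) 0"
    and sub: "\<And>u. chart_values \<mu> \<alpha> z u \<subseteq> I u" and herm: "in_hermitian C"
    and \<kappa>: "\<And>V :: 'r \<times> 'r \<Rightarrow> 'r cmat. (\<And>q. hermitian (V q)) \<Longrightarrow> du_form V = \<kappa> * of_real (dU_form V)"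
  shows "\<exists>y. has_dU_integral I C y \<and> radon_hgf \<mu> z \<alpha> C = \<kappa> * y"
proof (intro exI conjI)
  let ?J = "\<lambda>\<sigma>. set_lebesgue_integral lborel open_spx
            (\<lambda>s. C \<sigma> (bary s) (affpt (spx_u \<sigma> s)) * of_real (dU_form (spx_tangent \<sigma> s)))"
  show "has_dU_integral I C (\<Sum>\<^sub>\<infinity>\<sigma>\<in>csupp C. ?J \<sigma>)"
    unfolding has_dU_integral_def
    using carries_mono [OF carries_chart_values [OF chain \<mu> z0]] sub herm by blast
  have "set_lebesgue_integral lborel open_spx
            (\<lambda>s. C \<sigma> (bary s) (affpt (spx_u \<sigma> s)) * du_form (spx_tangent \<sigma> s)) = \<kappa> * ?J \<sigma>"
    if \<sigma>: "\<sigma> \<in> csupp C" for \<sigma>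
  proof -
    have "du_form (spx_tangent \<sigma> s) = \<kappa> * of_real (dU_form (spx_tangent \<sigma> s))" if "s \<in> open_spx" for s
      using open_spx_subset that
      by (intro \<kappa> spx_tangent_hermitian [OF chain \<sigma> \<mu> z0] in_hermitian_spx_u [OF herm \<sigma>]) auto
    then have eq: "indicator open_spx s *\<^sub>R (C \<sigma> (bary s) (affpt (spx_u \<sigma> s)) * du_form (spx_tangent \<sigma> s))
       = \<kappa> * (indicator open_spx s *\<^sub>R (C \<sigma> (bary s) (affpt (spx_u \<sigma> s)) * of_real (dU_form (spx_tangent \<sigma> s))))" for s
      by (cases "s \<in> open_spx") auto
    show ?thesis
      unfolding set_lebesgue_integral_def eq by (rule integral_mult_right_zero)
  qed
  then show "radon_hgf \<mu> z \<alpha> C = \<kappa> * (\<Sum>\<^sub>\<infinity>\<sigma>\<in>csupp C. ?J \<sigma>)"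
    unfolding radon_hgf_chart [OF chain \<mu> z0] infsum_cmult_right' [symmetric] by (intro infsum_cong)
qed

section \<open>Hermitian matrices as a real form\<close>

text \<open>
  \<open>herm_entry\<close> takes the real coordinates of a Hermitian matrix to its entries; the entry
  \<open>(i, j)\<close> only involves the coordinates \<open>(i, j)\<close> and \<open>(j, i)\<close>.
\<close>

definition herm_diag :: "'r::{finite,wellorder} \<times> 'r \<Rightarrow> complex" where
  "herm_diag p = (if fst p \<le> snd p then 1 else - \<i>)"

definition herm_swap :: "'r::{finite,wellorder} \<times> 'r \<Rightarrow> complex" where
  "herm_swap p = (if fst p < snd p then \<i> else if fst p = snd p then 0 else 1)"

definition herm_entry :: "complex^('r::{finite,wellorder} \<times> 'r)^('r \<times> 'r)" where
  "herm_entry = (\<chi> p q. (if q = p then herm_diag p else 0) + (if q = prod.swap p then herm_swap p else 0))"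

lemma herm_entry_sum:
  "(\<Sum>q\<in>UNIV. herm_entry $ p $ q * f q) = herm_diag p * f p + herm_swap p * f (prod.swap p)"
  by (simp add: herm_entry_def distrib_right sum.distrib if_distrib [of "\<lambda>c. c * _"] sum.delta
      cong: if_cong)

lemma hermitian_entry:
  assumes "hermitian U"
  shows "U $ fst p $ snd p = herm_diag p * of_real (hcoord U $ p) + herm_swap p * of_real (hcoord U $ prod.swap p)"
proof -
  have cnj: "U $ i $ j = cnj (U $ j $ i)" for i j
    using assms unfolding hermitian_def by blast
  have Im0: "Im (U $ i $ i) = 0" for i
    using cnj [of i i] by (simp add: complex_eq_iff)
  consider "fst p < snd p" | "fst p = snd p" | "snd p < fst p" by fastforce
  then show ?thesis
  proof cases
    case 3
    then show ?thesis
      using cnj [of "fst p" "snd p"] by (auto simp add: herm_diag_def herm_swap_def hcoord_def complex_eq_iff not_less less_imp_le)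
  qed (auto simp: herm_diag_def herm_swap_def hcoord_def complex_eq_iff Im0)
qed

text \<open>An index (i, i) contributes the entry 1, and a pair i < j contributes the block with
  rows (1, \<i>) and (1, - \<i>), of determinant -2 \<i>. The determinant is thus (-2 \<i>)^(r (r -
  1) / 2). Only its nonvanishing is proved, from the trivial kernel: the equations at p and at its
  swap force both coordinates to be 0.\<close>

lemma det_herm_entry: "det (herm_entry :: complex^('r::{finite,wellorder} \<times> 'r)^('r \<times> 'r)) \<noteq> 0"
proof -
  have "x = 0" if "herm_entry *v x = 0" for x :: "complex^('r \<times> 'r)"
  proof -
    have eq: "herm_diag p * x $ p + herm_swap p * x $ prod.swap p = 0" for p
      using that unfolding vec_eq_iff matrix_vector_mult_def
      by (simp add: herm_entry_sum del: split_paired_All)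
    have "x $ p = 0" for p
      using eq [of p] eq [of "prod.swap p"]
      by (cases "fst p" "snd p" rule: linorder_cases)
        (auto simp: herm_diag_def herm_swap_def complex_eq_iff split: if_splits)
    then show ?thesis
      by (simp add: vec_eq_iff)
  qed
  then obtain B where "B ** (herm_entry :: complex^('r \<times> 'r)^('r \<times> 'r)) = mat 1"
    using matrix_left_invertible_ker by blast
  then show ?thesis
    using invertible_det_nz invertible_left_inverse by blast
qed

lemma det_of_real: "det (\<chi> i j. complex_of_real (A $ i $ j)) = of_real (det (A :: real^'n^'n))"
  by (simp add: det_def)

text \<open>The matrix of entries of the V q is \<open>herm_entry\<close> times the matrix of their
  real coordinates, and the determinant is multiplicative.\<close>

lemma du_form_hermitian:
  fixes V :: "'r::{finite,wellorder} \<times> 'r \<Rightarrow> 'r cmat"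
  assumes "\<And>q. hermitian (V q)"
  shows "du_form V = det (herm_entry :: complex^('r \<times> 'r)^('r \<times> 'r)) * of_real (dU_form V)"
proof -
  let ?H = "\<chi> p q. hcoord (V q) $ p :: real^('r \<times> 'r)^('r \<times> 'r)"
  have "(\<chi> p q. V q $ fst p $ snd p) = herm_entry ** (\<chi> p q. complex_of_real (?H $ p $ q))"
    by (simp add: vec_eq_iff matrix_matrix_mult_def herm_entry_sum hermitian_entry [OF assms, symmetric]
        del: split_paired_All)
  then have "du_form V = det (herm_entry ** (\<chi> p q. complex_of_real (?H $ p $ q)))"
    by (simp add: du_form_def)
  then show ?thesis
    unfolding det_mul det_of_real dU_form_def .
qed

section \<open>The real vector space of Hermitian matrices\<close>

lemma linear_hmat: "linear hmat"
  by (auto intro!: linearI simp: hmat_def vec_eq_iff complex_eq_iff)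

lemma hermitian_hmat: "hermitian (hmat v)"
  by (auto simp: hermitian_def hmat_def complex_eq_iff)

lemma hcoord_hmat [simp]: "hcoord (hmat v) = v"
  by (auto simp: hcoord_def hmat_def vec_eq_iff)

lemma hmat_hcoord: 
  assumes "hermitian U"
  shows "hmat (hcoord U) = U"
proof -
  have Re: "Re (U $ i $ j) = Re (U $ j $ i)" and Im: "Im (U $ i $ j) = - Im (U $ j $ i)" for i j
    using assms unfolding hermitian_def by (metis cnj.sel)+
  have "Im (U $ i $ i) = 0" for i
    using Im [of i i] by simp
  then have "hmat (hcoord U) $ i $ j = U $ i $ j" for i j
    using Re [of i j] Im [of i j]
    by (cases i j rule: linorder_cases) (auto simp: hcoord_def hmat_def complex_eq_iff)
  then show ?thesis
    by (simp add: vec_eq_iff)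
qed

lemma hermitian_eq_range: "{U :: 'r::{finite,wellorder} cmat. hermitian U} = range hmat"
  by (auto simp: hermitian_hmat intro: range_eqI [where f = hmat, OF hmat_hcoord [symmetric]])

lemma linear_hcoord: "linear hcoord"
  by (auto intro!: linearI simp: hcoord_def vec_eq_iff)

lemma subspace_hermitian: "subspace {U :: 'r::{finite,wellorder} cmat. hermitian U}"
  unfolding hermitian_eq_range by (intro linear_subspace_image linear_hmat subspace_UNIV)

lemma dim_hermitian: "dim {U :: 'r::{finite,wellorder} cmat. hermitian U} = CARD('r) * CARD('r)"
proof -
  have "inj (hmat :: _ \<Rightarrow> 'r cmat)"
    by (metis hcoord_hmat injI)
  then have "dim (range (hmat :: _ \<Rightarrow> 'r cmat)) = dim (UNIV :: (real^('r \<times> 'r)) set)"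
    by (intro dim_image_eq linear_hmat) (simp add: inj_on_subset)
  then show ?thesis
    by (simp add: hermitian_eq_range)
qed

lemma mat_mult_nth: "(mat c ** (B :: 'a::semiring_1^'n^'n)) $ i $ j = c * B $ i $ j"
  by (simp add: matrix_matrix_mult_def mat_def if_distrib [of "\<lambda>c. c * _"] sum.delta cong: if_cong)

text \<open>With M^H the conjugate transpose, A = (M + M^H) / 2 and B = (M - M^H) / (2 \<i>). For
  uniqueness, conjugate transposition turns A' + \<i> B' into A' - \<i> B', and the two expressions
  determine A' and B'.\<close>

lemma hermitian_decomposition:
  "\<exists>!(A, B). hermitian A \<and> hermitian B \<and> (M :: 'r::finite cmat) = A + mat \<i> ** B"
proof -
  define A :: "'r cmat" where "A = (\<chi> i j. (M $ i $ j + cnj (M $ j $ i)) / 2)"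
  define B :: "'r cmat" where "B = (\<chi> i j. \<i> * (cnj (M $ j $ i) - M $ i $ j) / 2)"
  have ex: "hermitian A \<and> hermitian B \<and> M = A + mat \<i> ** B"
    by (auto simp: A_def B_def hermitian_def vec_eq_iff mat_mult_nth complex_eq_iff field_simps)
  have uniq: "A' = A \<and> B' = B" if h: "hermitian A'" "hermitian B'" and M: "M = A' + mat \<i> ** B'" for A' B'
  proof -
    have 1: "M $ i $ j = A' $ i $ j + \<i> * B' $ i $ j" for i j
      by (simp add: M mat_mult_nth)
    have 2: "cnj (M $ j $ i) = A' $ i $ j - \<i> * B' $ i $ j" for i j
    proof -
      have "cnj (A' $ j $ i) = A' $ i $ j" "cnj (B' $ j $ i) = B' $ i $ j"
        using h unfolding hermitian_def by metis+
      then show ?thesis by (simp add: 1)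
    qed
    show ?thesis
      unfolding A_def B_def 2 by (simp add: vec_eq_iff 1)
  qed
  show ?thesis
  proof (rule ex1I [of _ "(A, B)"])
    show "case (A, B) of (A, B) \<Rightarrow> hermitian A \<and> hermitian B \<and> M = A + mat \<i> ** B"
      using ex by (simp only: prod.case)
    fix P assume "case P of (A, B) \<Rightarrow> hermitian A \<and> hermitian B \<and> M = A + mat \<i> ** B"
    then show "P = (A, B)"
      using uniq by (cases P) (simp only: prod.case prod.inject, blast)
  qed
qed

section \<open>The integrands of the normal forms\<close>

lemma affpt_mult_vcat: "affpt u ** vcat P Q = P + u ** Q"
  by (simp add: affpt_def hcat_mult_vcat)

section \<open>Coefficients of truncated logarithms\<close>

lemma jmul_jone [simp]: "jmul f jone = f"
proof
  fix k
  have "jmul f jone k = (\<Sum>i\<le>k. if i = k then f i else 0)"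
    unfolding jmul_def jone_def by (intro sum.cong refl) auto
  then show "jmul f jone k = f k"
    by simp
qed

lemma atMost_simps: "{..Suc 0} = {0, Suc 0}" "{..2::nat} = {0, Suc 0, 2}" "{..3::nat} = {0, Suc 0, 2, 3}"
  and atLeastLessThan_simps: "{Suc 0..<2} = {Suc 0}" "{Suc 0..<3} = {Suc 0, 2}" "{Suc 0..<4} = {Suc 0, 2, 3}"
  by auto

lemma jpow_2_3: "jpow f 2 = jmul f f" "jpow f 3 = jmul f (jmul f f)"
  by (simp_all add: numeral_2_eq_2 numeral_3_eq_3)

lemma jtheta_2: "jtheta 2 h (Suc 0) = h (Suc 0)"
  by (simp add: jtheta_def atLeastLessThan_simps) (simp add: jone_def)

text \<open>With f = h - 1, log h = f - f^2 / 2 modulo w^3, and f_0 = 0 leaves only h_1^2 in f^2 at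
  w^2.\<close>

lemma jtheta_3:
  fixes h :: "nat \<Rightarrow> 'r::finite cmat"
  assumes "h 0 = mat 1"
  shows "jtheta 3 h (Suc 0) = h (Suc 0)" "jtheta 3 h 2 = h 2 - (1/2) *\<^sub>R (h (Suc 0) ** h (Suc 0))"
proof -
  define f where "f = (\<lambda>i. h i - jone i)"
  have f: "f 0 = 0" "f (Suc 0) = h (Suc 0)" "f 2 = h 2"
    using assms by (simp_all add: f_def jone_def)
  have "jtheta 3 h k = f k - (1/2) *\<^sub>R jmul f f k" for k
    by (simp add: jtheta_def atLeastLessThan_simps f_def [symmetric] jpow_2_3)
  then show "jtheta 3 h (Suc 0) = h (Suc 0)" "jtheta 3 h 2 = h 2 - (1/2) *\<^sub>R (h (Suc 0) ** h (Suc 0))"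
    by (simp_all add: jmul_def atMost_simps f)
qed

text \<open>With f = h - 1, log h = f - f^2 / 2 + f^3 / 3 modulo w^4. Since f_0 = f_2 = 0, the
  square reduces to h_1^2 w^2 and the cube to h_1^3 w^3; the mixed terms f_1 f_2 + f_2 f_1 at w^3
  vanish.\<close>

lemma jtheta_4:
  fixes h :: "nat \<Rightarrow> 'r::finite cmat"
  assumes "h 0 = mat 1" "h 2 = 0"
  shows "jtheta 4 h (Suc 0) = h (Suc 0)" "jtheta 4 h 2 = - (1/2) *\<^sub>R (h (Suc 0) ** h (Suc 0))"
    "jtheta 4 h 3 = h 3 + (1/3) *\<^sub>R (h (Suc 0) ** h (Suc 0) ** h (Suc 0))"
proof -
  define f where "f = (\<lambda>i. h i - jone i)"
  have f: "f 0 = 0" "f (Suc 0) = h (Suc 0)" "f 2 = 0" "f 3 = h 3"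
    using assms by (simp_all add: f_def jone_def)
  have *: "jtheta 4 h k = f k - (1/2) *\<^sub>R jmul f f k + (1/3) *\<^sub>R jmul f (jmul f f) k" for k
    by (simp add: jtheta_def atLeastLessThan_simps f_def [symmetric] jpow_2_3)
  have 2: "jmul f f 0 = 0" "jmul f f (Suc 0) = 0" "jmul f f 2 = h (Suc 0) ** h (Suc 0)" "jmul f f 3 = 0"
    by (simp_all add: jmul_def atMost_simps f)
  have 3: "jmul f (jmul f f) (Suc 0) = 0" "jmul f (jmul f f) 2 = 0"
    "jmul f (jmul f f) 3 = h (Suc 0) ** (h (Suc 0) ** h (Suc 0))"
    unfolding jmul_def [of f "jmul f f"] by (simp_all add: atMost_simps f 2)
  show "jtheta 4 h (Suc 0) = h (Suc 0)" "jtheta 4 h 2 = - (1/2) *\<^sub>R (h (Suc 0) ** h (Suc 0))"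
    "jtheta 4 h 3 = h 3 + (1/3) *\<^sub>R (h (Suc 0) ** h (Suc 0) ** h (Suc 0))"
    unfolding * by (simp_all add: 2 3 f matrix_mul_assoc)
qed

section \<open>Values of the character at the five normal forms\<close>

lemma mpowI: "exp l = w \<Longrightarrow> exp (a * l) \<in> mpow w a"
  by (auto simp: mpow_def)

lemma x_mat_simps:
  "x_mat [1, 1, 1, 1] x = [vcat (mat 1) 0, vcat 0 (mat 1), vcat (mat 1) (- mat 1), vcat (mat 1) (- x)]"
  "x_mat [2, 1, 1] x = [vcat (mat 1) 0, vcat 0 x, vcat 0 (mat 1), vcat (mat 1) (- mat 1)]"
  "x_mat [2, 2] x = [vcat (mat 1) 0, vcat 0 x, vcat 0 (mat 1), vcat (mat 1) 0]"
  "x_mat [3, 1] x = [vcat (mat 1) 0, vcat 0 (mat 1), vcat 0 x, vcat 0 (mat 1)]"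
  "x_mat [4] x = [vcat (mat 1) 0, vcat 0 (mat 1), vcat 0 0, vcat 0 x]"
  by (simp_all add: x_mat_def)

lemma mult_minus_right: "(u :: 'a::ring_1^'n^'m) ** (- x) = - (u ** x)"
  by (simp add: matrix_matrix_mult_def vec_eq_iff sum_negf)

lemma matrix_mult_0_right: "(u :: 'a::semiring_1^'n^'m) ** 0 = 0"
  by (simp add: matrix_matrix_mult_def vec_eq_iff)

lemma trace_uminus: "trace (- A :: 'a::ring_1^'n^'n) = - trace A"
  by (simp add: trace_def sum_negf)

lemmas tz_x_mat_simps = tz_def offs_def affpt_mult_vcat mult_minus_right matrix_mult_0_right

lemma junder_one: "h 0 = mat 1 \<Longrightarrow> junder h = h"
  by (simp add: junder_def fun_eq_iff)

lemma less_Suc_numeral: "{..<Suc 0} = {0}" "{..<2::nat} = {0, Suc 0}" "{..<3::nat} = {0, Suc 0, 2}" "{..<4::nat} = {0, Suc 0, 2, 3}"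
  by auto

lemma chart_values_1111:
  "chart_values [1, 1, 1, 1] \<alpha> (x_mat [1, 1, 1, 1] x) u \<subseteq>
     mpow (det u) (\<alpha> ! 1) * mpow (det (mat 1 - u)) (\<alpha> ! 2) * mpow (det (mat 1 - u ** x)) (\<alpha> ! 3)"
proof
  define \<mu> :: "nat list" where "\<mu> = [1, 1, 1, 1]"
  define h where "h = tz \<mu> (x_mat \<mu> x) (affpt u)"
  have h: "h (Suc 0) 0 = u" "h 2 0 = mat 1 - u" "h 3 0 = mat 1 - u ** x"
    unfolding h_def \<mu>_def x_mat_simps
    by (simp_all add: tz_x_mat_simps numeral_2_eq_2 numeral_3_eq_3)
  have \<mu>: "length \<mu> = 4" "\<mu> ! 0 = 1" "\<mu> ! Suc 0 = 1" "\<mu> ! 2 = 1" "\<mu> ! 3 = 1" "offs \<mu> (Suc 0) = 1" "offs \<mu> 2 = 2" "offs \<mu> 3 = 3"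
    by (simp_all add: \<mu>_def offs_def numeral_2_eq_2 numeral_3_eq_3)
  \<comment> \<open>Blocks of size 1 carry no index k with 1 \<le> k < 1, so the exponent is an
    empty sum.\<close>
  have e: "expo \<mu> \<alpha> h = 0"
    by (simp add: expo_def \<mu> less_Suc_numeral atLeastLessThan_simps jtheta_2 jtheta_3 jtheta_4 junder_one h)
  fix y assume "y \<in> chart_values [1, 1, 1, 1] \<alpha> (x_mat [1, 1, 1, 1] x) u"
  then obtain l where l: "\<And>j. j \<in> {1..<4} \<Longrightarrow> exp (l j) = det (h j 0)"
    and y: "y = (\<Prod>j=1..<4. exp (\<alpha> ! offs \<mu> j * l j)) * exp (expo \<mu> \<alpha> h)"
    unfolding chart_values_def \<mu>_def [symmetric] h_def [symmetric] \<mu>(1) by blast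
  have "y = exp (\<alpha> ! 1 * l (Suc 0)) * exp (\<alpha> ! 2 * l 2) * exp (\<alpha> ! 3 * l 3)"
    unfolding y e by (simp add: atLeastLessThan_simps \<mu> mult_ac)
  then show "y \<in> mpow (det u) (\<alpha> ! 1) * mpow (det (mat 1 - u)) (\<alpha> ! 2) * mpow (det (mat 1 - u ** x)) (\<alpha> ! 3)"
    using l [of "Suc 0"] l [of 2] l [of 3] by (auto intro!: set_times_intro mpowI simp: h)
qed

lemma chart_values_211:
  "chart_values [2, 1, 1] \<alpha> (x_mat [2, 1, 1] x) u \<subseteq>
     {exp (\<alpha> ! 1 * trace (u ** x))} * mpow (det u) (\<alpha> ! 2) * mpow (det (mat 1 - u)) (\<alpha> ! 3)"
proof
  define \<mu> :: "nat list" where "\<mu> = [2, 1, 1]"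
  define h where "h = tz \<mu> (x_mat \<mu> x) (affpt u)"
  have h: "h 0 0 = mat 1" "h 0 (Suc 0) = u ** x" "h (Suc 0) 0 = u" "h 2 0 = mat 1 - u"
    unfolding h_def \<mu>_def x_mat_simps
    by (simp_all add: tz_x_mat_simps numeral_2_eq_2 numeral_3_eq_3)
  have \<mu>: "length \<mu> = 3" "\<mu> ! 0 = 2" "\<mu> ! Suc 0 = 1" "\<mu> ! 2 = 1" "offs \<mu> 0 = 0" "offs \<mu> (Suc 0) = 2" "offs \<mu> 2 = 3"
    by (simp_all add: \<mu>_def offs_def numeral_2_eq_2 numeral_3_eq_3)
  have e: "expo \<mu> \<alpha> h = \<alpha> ! 1 * trace (u ** x)"
    by (simp add: expo_def \<mu> less_Suc_numeral atLeastLessThan_simps jtheta_2 jtheta_3 jtheta_4 junder_one h)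
  fix y assume "y \<in> chart_values [2, 1, 1] \<alpha> (x_mat [2, 1, 1] x) u"
  then obtain l where l: "\<And>j. j \<in> {1..<3} \<Longrightarrow> exp (l j) = det (h j 0)"
    and y: "y = (\<Prod>j=1..<3. exp (\<alpha> ! offs \<mu> j * l j)) * exp (expo \<mu> \<alpha> h)"
    unfolding chart_values_def \<mu>_def [symmetric] h_def [symmetric] \<mu>(1) by blast
  have "y = exp (\<alpha> ! 1 * trace (u ** x)) * exp (\<alpha> ! 2 * l (Suc 0)) * exp (\<alpha> ! 3 * l 2)"
    unfolding y e by (simp add: atLeastLessThan_simps \<mu> mult_ac)
  then show "y \<in> {exp (\<alpha> ! 1 * trace (u ** x))} * mpow (det u) (\<alpha> ! 2) * mpow (det (mat 1 - u)) (\<alpha> ! 3)"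
    using l [of "Suc 0"] l [of 2] by (auto intro!: set_times_intro mpowI simp: h)
qed

lemma chart_values_22:
  "chart_values [2, 2] \<alpha> (x_mat [2, 2] x) u \<subseteq>
     {exp (\<alpha> ! 1 * trace (u ** x))} * mpow (det u) (\<alpha> ! 2) * {exp (\<alpha> ! 3 * trace (matrix_inv u))}"
proof
  define \<mu> :: "nat list" where "\<mu> = [2, 2]"
  define h where "h = tz \<mu> (x_mat \<mu> x) (affpt u)"
  have h: "h 0 0 = mat 1" "h 0 (Suc 0) = u ** x" "h (Suc 0) 0 = u" "h (Suc 0) (Suc 0) = mat 1"
    unfolding h_def \<mu>_def x_mat_simps
    by (simp_all add: tz_x_mat_simps numeral_2_eq_2 numeral_3_eq_3)
  have \<mu>: "length \<mu> = 2" "\<mu> ! 0 = 2" "\<mu> ! (Suc 0) = 2" "offs \<mu> 0 = 0" "offs \<mu> (Suc 0) = 2"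
    by (simp_all add: \<mu>_def offs_def numeral_2_eq_2 numeral_3_eq_3)
  \<comment> \<open>Origin of the trace of u^-1: the second block is u + w, and
    \<open>junder\<close> divides it by its leading coefficient u.\<close>
  have j: "junder (h (Suc 0)) (Suc 0) = matrix_inv u"
    by (simp add: junder_def h)
  have e: "expo \<mu> \<alpha> h = \<alpha> ! 1 * trace (u ** x) + \<alpha> ! 3 * trace (matrix_inv u)"
    by (simp add: expo_def \<mu> less_Suc_numeral atLeastLessThan_simps jtheta_2 jtheta_3 jtheta_4 junder_one h j)
  fix y assume "y \<in> chart_values [2, 2] \<alpha> (x_mat [2, 2] x) u"
  then obtain l where l: "\<And>j. j \<in> {1..<2} \<Longrightarrow> exp (l j) = det (h j 0)"
    and y: "y = (\<Prod>j=1..<2. exp (\<alpha> ! offs \<mu> j * l j)) * exp (expo \<mu> \<alpha> h)"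
    unfolding chart_values_def \<mu>_def [symmetric] h_def [symmetric] \<mu>(1) by blast
  have "y = exp (\<alpha> ! 1 * trace (u ** x)) * exp (\<alpha> ! 2 * l (Suc 0)) * exp (\<alpha> ! 3 * trace (matrix_inv u))"
    unfolding y e by (simp add: atLeastLessThan_simps \<mu> exp_add mult_ac)
  then show "y \<in> {exp (\<alpha> ! 1 * trace (u ** x))} * mpow (det u) (\<alpha> ! 2) * {exp (\<alpha> ! 3 * trace (matrix_inv u))}"
    using l [of "Suc 0"] by (auto intro!: set_times_intro mpowI simp: h)
qed

lemma chart_values_31:
  "chart_values [3, 1] \<alpha> (x_mat [3, 1] x) u \<subseteq>
     {exp (\<alpha> ! 1 * trace u + \<alpha> ! 2 * trace (u ** x - (1/2) *\<^sub>R (u ** u)))} * mpow (det u) (\<alpha> ! 3)"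
proof
  define \<mu> :: "nat list" where "\<mu> = [3, 1]"
  define h where "h = tz \<mu> (x_mat \<mu> x) (affpt u)"
  have h: "h 0 0 = mat 1" "h 0 (Suc 0) = u" "h 0 2 = u ** x" "h (Suc 0) 0 = u"
    unfolding h_def \<mu>_def x_mat_simps
    by (simp_all add: tz_x_mat_simps numeral_2_eq_2 numeral_3_eq_3)
  have \<mu>: "length \<mu> = 2" "\<mu> ! 0 = 3" "\<mu> ! Suc 0 = 1" "offs \<mu> 0 = 0" "offs \<mu> (Suc 0) = 3"
    by (simp_all add: \<mu>_def offs_def numeral_2_eq_2 numeral_3_eq_3)
  have e: "expo \<mu> \<alpha> h = \<alpha> ! 1 * trace u + \<alpha> ! 2 * trace (u ** x - (1/2) *\<^sub>R (u ** u))"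
    by (simp add: expo_def \<mu> less_Suc_numeral atLeastLessThan_simps jtheta_2 jtheta_3 jtheta_4 junder_one h)
  fix y assume "y \<in> chart_values [3, 1] \<alpha> (x_mat [3, 1] x) u"
  then obtain l where l: "\<And>j. j \<in> {1..<2} \<Longrightarrow> exp (l j) = det (h j 0)"
    and y: "y = (\<Prod>j=1..<2. exp (\<alpha> ! offs \<mu> j * l j)) * exp (expo \<mu> \<alpha> h)"
    unfolding chart_values_def \<mu>_def [symmetric] h_def [symmetric] \<mu>(1) by blast
  have "y = exp (\<alpha> ! 1 * trace u + \<alpha> ! 2 * trace (u ** x - (1/2) *\<^sub>R (u ** u))) * exp (\<alpha> ! 3 * l (Suc 0))"
    unfolding y e by (simp add: atLeastLessThan_simps \<mu> mult_ac)
  then show "y \<in> {exp (\<alpha> ! 1 * trace u + \<alpha> ! 2 * trace (u ** x - (1/2) *\<^sub>R (u ** u)))} * mpow (det u) (\<alpha> ! 3)"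
    using l [of "Suc 0"] by (auto intro!: set_times_intro mpowI simp: h)
qed

text \<open>The only block is 1 + u w + u x w^3, with no term at w^2, as \<open>jtheta_4\<close>
  requires. The cubic term of the logarithm enters with a plus sign.\<close>

lemma chart_values_4:
  "chart_values [4] \<alpha> (x_mat [4] x) u \<subseteq>
     {exp (\<alpha> ! 1 * trace u + \<alpha> ! 2 * trace (- (1/2) *\<^sub>R (u ** u)) +
           \<alpha> ! 3 * trace (u ** x + (1/3) *\<^sub>R (u ** u ** u)))}"
proof -
  let ?h = "tz [4] (x_mat [4] x) (affpt u)"
  have h: "?h 0 0 = mat 1" "?h 0 (Suc 0) = u" "?h 0 2 = 0" "?h 0 3 = u ** x"
    by (simp_all add: tz_x_mat_simps x_mat_simps(5) numeral_2_eq_2 numeral_3_eq_3)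
  have "offs [4] 0 = 0"
    by (simp add: offs_def)
  then have "expo [4] \<alpha> ?h = \<alpha> ! 1 * trace u + \<alpha> ! 2 * trace (- (1/2) *\<^sub>R (u ** u)) +
           \<alpha> ! 3 * trace (u ** x + (1/3) *\<^sub>R (u ** u ** u))"
    by (simp add: expo_def less_Suc_numeral atLeastLessThan_simps jtheta_4 junder_one h)
  then show ?thesis
    unfolding chart_values_def by simp
qed

section \<open>Change of variables over an index type without an order\<close>

text \<open>
  The change of variables theorem of the library asks for a well-ordered index type, whereas
  products carry the componentwise order.  Reindexing the coordinates along a bijection
  preserves Lebesgue measure and Jacobian determinants.
\<close>

lemma det_reindex:
  fixes A :: "'a::comm_ring_1^'k^'k" and e :: "'m::finite \<Rightarrow> 'k::finite"
  assumes e: "bij e"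
  shows "det (\<chi> a b. A $ e a $ e b) = det A"
proof -
  let ?F = "map_permutation UNIV e" and ?G = "map_permutation UNIV (inv_into UNIV e)"
  have bij: "bij_betw e UNIV UNIV" "bij_betw (inv_into UNIV e) UNIV UNIV"
    using e bij_imp_bij_inv by auto
  have rng: "range e = UNIV"
    using e by (simp add: bij_is_surj)
  have F: "?F p = e \<circ> p \<circ> inv_into UNIV e" for p
    by (simp add: map_permutation_def rng restrict_id_def fun_eq_iff)
  have G: "?G p = inv_into UNIV e \<circ> p \<circ> e" for p
    using bij(2) e by (simp add: map_permutation_def restrict_id_def fun_eq_iff bij_is_surj inv_inv_eq)
  have iv: "inv_into UNIV e (e x) = x" "e (inv_into UNIV e y) = y" for x y
    using e by (simp_all add: bij_is_inj bij_is_surj surj_f_inv_f)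
  have "(\<Sum>p | p permutes UNIV. of_int (sign p) * (\<Prod>i\<in>UNIV. A $ e i $ e (p i)))
      = (\<Sum>p | p permutes UNIV. of_int (sign p) * (\<Prod>i\<in>UNIV. A $ i $ p i))"
  proof (rule sum.reindex_bij_witness [where i = ?G and j = ?F])
    fix p assume p: "p \<in> {p. p permutes (UNIV :: 'm set)}"
    show "?G (?F p) = p"
      by (simp add: F G fun_eq_iff iv)
    show "?F p \<in> {p. p permutes UNIV}"
      using map_permutation_permutes [OF bij(1)] p by auto
    have "sign (?F p) = sign p"
      using p e by (intro sign_map_permutation) (auto simp: bij_is_inj)
    moreover have "(\<Prod>i\<in>UNIV. A $ i $ ?F p i) = (\<Prod>i\<in>UNIV. A $ e i $ ?F p (e i))"
      using prod.reindex_bij_betw [OF bij(1), of "\<lambda>i. A $ i $ ?F p i"] by simp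
    ultimately show "of_int (sign (?F p)) * (\<Prod>i\<in>UNIV. A $ i $ ?F p i)
        = of_int (sign p) * (\<Prod>i\<in>UNIV. A $ e i $ e (p i))"
      by (simp add: F iv)
  next
    fix p assume p: "p \<in> {p. p permutes (UNIV :: 'k set)}"
    show "?F (?G p) = p"
      by (simp add: F G fun_eq_iff iv)
    show "?G p \<in> {p. p permutes UNIV}"
      using map_permutation_permutes [OF bij(2)] p by auto
  qed
  then show ?thesis
    by (simp add: det_def)
qed

section \<open>Lebesgue measure under a permutation of coordinates\<close>

definition reindex :: "('k \<Rightarrow> 'm) \<Rightarrow> real^'m \<Rightarrow> real^'k" where
  "reindex d x = (\<chi> k. x $ d k)"

lemma linear_reindex: "linear (reindex d)"
  by (auto intro!: linearI simp: reindex_def vec_eq_iff)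

lemma continuous_on_reindex: "continuous_on S (reindex d)"
  by (intro linear_continuous_on linear_conv_bounded_linear [THEN iffD1] linear_reindex)

lemma reindex_reindex [simp]: "reindex d (reindex e x) = reindex (e \<circ> d) x"
  by (simp add: reindex_def)

lemma reindex_id [simp]: "reindex id x = x"
  by (simp add: reindex_def vec_eq_iff)

lemma prod_Basis_cart: "(\<Prod>b\<in>Basis. (v :: real^'n) \<bullet> b) = (\<Prod>i\<in>UNIV. v $ i)"
proof -
  have B: "Basis = range (\<lambda>i :: 'n. axis i (1::real))"
    by (auto simp: Basis_vec_def)
  have "inj (\<lambda>i :: 'n. axis i (1::real))"
    by (auto simp: inj_def axis_eq_axis)
  then show ?thesis
    unfolding B by (simp add: prod.reindex inner_axis)
qed

text \<open>Lebesgue measure is determined by its values on boxes, and the preimage of a box has the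
  same side lengths in another order.\<close>

lemma distr_lborel_reindex:
  fixes d :: "'k::finite \<Rightarrow> 'm::finite"
  assumes d: "bij d"
  shows "distr lborel borel (reindex d) = lborel"
proof (rule lborel_eqI [symmetric])
  have iv: "inv_into UNIV d (d x) = x" "d (inv_into UNIV d y) = y" for x y
    using d by (simp_all add: bij_is_inj bij_is_surj surj_f_inv_f)
  have m: "reindex d \<in> lborel \<rightarrow>\<^sub>M borel"
    using borel_measurable_continuous_onI [OF continuous_on_reindex] by simp
  fix l u :: "real^'k" assume lu: "\<And>b. b \<in> Basis \<Longrightarrow> l \<bullet> b \<le> u \<bullet> b"
  then have le: "l $ k \<le> u $ k" for k
    using lu [of "axis k 1"] by (simp add: inner_axis)
  have "reindex d -` box l u = box (reindex (inv_into UNIV d) l) (reindex (inv_into UNIV d) u)"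
    unfolding Set.set_eq_iff vimage_eq mem_box_cart reindex_def vec_lambda_beta by (metis iv)
  then have "emeasure (distr lborel borel (reindex d)) (box l u)
      = emeasure lborel (box (reindex (inv_into UNIV d) l) (reindex (inv_into UNIV d) u))"
    using m by (simp add: emeasure_distr)
  also have "\<dots> = (\<Prod>b\<in>Basis. (reindex (inv_into UNIV d) u - reindex (inv_into UNIV d) l) \<bullet> b)"
    by (rule emeasure_lborel_box) (use le in \<open>auto simp: Basis_vec_def inner_axis reindex_def\<close>)
  also have "(\<Prod>b\<in>Basis. (reindex (inv_into UNIV d) u - reindex (inv_into UNIV d) l) \<bullet> b) = (\<Prod>m\<in>UNIV. (u - l) $ inv_into UNIV d m)"
    unfolding prod_Basis_cart by (simp add: reindex_def)
  also have "\<dots> = (\<Prod>k\<in>UNIV. (u - l) $ k)"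
    using prod.reindex_bij_betw [OF bij_imp_bij_inv [OF d], of "\<lambda>k. (u - l) $ k"] by simp
  finally show "emeasure (distr lborel borel (reindex d)) (box l u) = (\<Prod>b\<in>Basis. (u - l) \<bullet> b)"
    unfolding prod_Basis_cart .
qed simp

text \<open>Carries the Borel statement over to the completed measure, with which the change of
  variables works.\<close>

lemma reindex_lebesgue:
  fixes d :: "'k::finite \<Rightarrow> 'm::finite"
  assumes d: "bij d"
  shows "reindex d \<in> lebesgue \<rightarrow>\<^sub>M lebesgue" and "distr lebesgue lebesgue (reindex d) = lebesgue"
proof -
  have "reindex d \<in> lborel \<rightarrow>\<^sub>M lborel"
    using borel_measurable_continuous_onI [OF continuous_on_reindex] by simp
  note m = measurable_completion [OF this]
  have "distr lebesgue lborel (reindex d) = distr lborel lborel (reindex d)"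
    by (rule distr_completion) fact
  also have "\<dots> = distr lborel borel (reindex d)"
    by (rule distr_cong) auto
  finally have *: "distr lebesgue lborel (reindex d) = lborel"
    by (simp add: distr_lborel_reindex [OF d])
  show "reindex d \<in> lebesgue \<rightarrow>\<^sub>M lebesgue"
    by (rule completion.measurable_completion2 [OF m]) (simp add: *)
  have "distr lebesgue lebesgue (reindex d) = completion (distr lebesgue lborel (reindex d))"
    by (rule completion.completion_distr_eq [OF m, symmetric]) (simp add: *)
  then show "distr lebesgue lebesgue (reindex d) = lebesgue"
    by (simp add: *)
qed

lemma set_integral_reindex:
  fixes d :: "'k::finite \<Rightarrow> 'm::finite" and f :: "real^'k \<Rightarrow> 'b::euclidean_space"
  assumes d: "bij d" and f: "set_integrable lebesgue S f"
  shows "set_integrable lebesgue (reindex d -` S) (f \<circ> reindex d)"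
    and "set_lebesgue_integral lebesgue (reindex d -` S) (f \<circ> reindex d) = set_lebesgue_integral lebesgue S f"
proof -
  let ?h = "\<lambda>y. indicator S y *\<^sub>R f y"
  have h: "integrable (distr lebesgue lebesgue (reindex d)) ?h"
    using f unfolding set_integrable_def reindex_lebesgue(2) [OF d] .
  note m = reindex_lebesgue(1) [OF d]
  have eq: "indicator (reindex d -` S) x *\<^sub>R (f \<circ> reindex d) x = ?h (reindex d x)" for x
    by (simp add: indicator_def)
  show "set_integrable lebesgue (reindex d -` S) (f \<circ> reindex d)"
    unfolding set_integrable_def eq by (rule integrable_distr [OF m h])
  have "integral\<^sup>L (distr lebesgue lebesgue (reindex d)) ?h = integral\<^sup>L lebesgue (\<lambda>x. ?h (reindex d x))"
    using f by (intro integral_distr m) (simp add: set_integrable_def)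
  then show "set_lebesgue_integral lebesgue (reindex d -` S) (f \<circ> reindex d) = set_lebesgue_integral lebesgue S f"
    unfolding set_lebesgue_integral_def eq reindex_lebesgue(2) [OF d] by simp
qed

text \<open>\<open>has_absolute_integral_change_of_variables\<close> speaks of values in a space
  \<open>real^'n\<close>. L and K identify the complex numbers with \<open>real^2\<close>; being
  bounded linear, they commute with the integral and with the real Jacobian factor.\<close>

lemma change_of_variables_complex:
  fixes f :: "real^'m::{finite,wellorder} \<Rightarrow> complex" and g :: "real^'m::_ \<Rightarrow> real^'m::_"
  assumes S: "S \<in> sets lebesgue"
    and der: "\<And>x. x \<in> S \<Longrightarrow> (g has_derivative g' x) (at x within S)"
    and inj: "inj_on g S" and f: "set_integrable lebesgue (g ` S) f"
  shows "set_integrable lebesgue S (\<lambda>x. \<bar>det (matrix (g' x))\<bar> *\<^sub>R f (g x))"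
    and "set_lebesgue_integral lebesgue S (\<lambda>x. \<bar>det (matrix (g' x))\<bar> *\<^sub>R f (g x))
       = set_lebesgue_integral lebesgue (g ` S) f"
proof -
  define L :: "complex \<Rightarrow> real^2" where "L c = (\<chi> i. if i = 1 then Re c else Im c)" for c
  define K :: "real^2 \<Rightarrow> complex" where "K v = Complex (v $ 1) (v $ 2)" for v
  have L: "bounded_linear L"
    by (intro linear_conv_bounded_linear [THEN iffD1] linearI) (auto simp: L_def vec_eq_iff)
  have K: "bounded_linear K"
    by (intro linear_conv_bounded_linear [THEN iffD1] linearI) (auto simp: K_def complex_eq_iff)
  have KL: "K (L c) = c" for c
    by (simp add: K_def L_def)
  let ?D = "\<lambda>x. \<bar>det (matrix (g' x))\<bar> *\<^sub>R (L \<circ> f) (g x)"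
  have Lf: "(L \<circ> f) absolutely_integrable_on g ` S"
    by (rule absolutely_integrable_linear [OF f L])
  have D: "?D absolutely_integrable_on S" "integral S ?D = integral (g ` S) (L \<circ> f)"
    using has_absolute_integral_change_of_variables [OF S der inj, of "L \<circ> f" "integral (g ` S) (L \<circ> f)"] Lf
    by auto
  have KD: "K \<circ> ?D = (\<lambda>x. \<bar>det (matrix (g' x))\<bar> *\<^sub>R f (g x))"
    by (simp add: fun_eq_iff linear_scale [OF bounded_linear.linear [OF K]] KL)
  show int: "set_integrable lebesgue S (\<lambda>x. \<bar>det (matrix (g' x))\<bar> *\<^sub>R f (g x))"
    using absolutely_integrable_linear [OF D(1) K] unfolding KD .
  have "integral S (K \<circ> ?D) = K (integral S ?D)"
    by (rule integral_linear [OF _ K]) (use D(1) set_lebesgue_integral_eq_integral(1) in blast)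
  also have "\<dots> = K (L (integral (g ` S) f))"
    unfolding D(2) by (subst integral_linear [OF _ L]) (use f set_lebesgue_integral_eq_integral(1) in auto)
  finally show "set_lebesgue_integral lebesgue S (\<lambda>x. \<bar>det (matrix (g' x))\<bar> *\<^sub>R f (g x))
       = set_lebesgue_integral lebesgue (g ` S) f"
    using set_lebesgue_integral_eq_integral(2) [OF int] set_lebesgue_integral_eq_integral(2) [OF f]
    unfolding KD KL by simp
qed

lemma change_of_variables_reindex:
  fixes f :: "real^'k \<Rightarrow> complex" and g :: "real^'k \<Rightarrow> real^'k" and e :: "'m::{finite,wellorder} \<Rightarrow> 'k"
  assumes e: "bij e" and S: "open S"
    and der: "\<And>x. x \<in> S \<Longrightarrow> (g has_derivative g' x) (at x)"
    and inj: "inj_on g S" and f: "set_integrable lebesgue (g ` S) f"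
  shows "set_lebesgue_integral lebesgue S (\<lambda>x. \<bar>det (matrix (g' x))\<bar> *\<^sub>R f (g x))
       = set_lebesgue_integral lebesgue (g ` S) f"
proof -
  let ?P = "reindex (inv_into UNIV e)" and ?Q = "reindex e"
  have iv: "e \<circ> inv_into UNIV e = id" "inv_into UNIV e \<circ> e = id"
    using e by (auto simp: fun_eq_iff bij_is_inj bij_is_surj surj_f_inv_f)
  have bl: "bounded_linear ?P" "bounded_linear ?Q"
    by (intro linear_conv_bounded_linear [THEN iffD1] linear_reindex)+
  have bij: "bij (inv_into UNIV e)"
    using e by (rule bij_imp_bij_inv)
  \<comment> \<open>The problem is conjugated to the ordered index type; \<open>?P\<close> and
    \<open>?Q\<close> are mutually inverse coordinate permutations.\<close>
  define T where "T = ?P -` S"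
  define G where "G = ?Q \<circ> g \<circ> ?P"
  define G' where "G' x = ?Q \<circ> g' (?P x) \<circ> ?P" for x
  have T: "open T"
    unfolding T_def by (rule open_vimage [OF S continuous_on_reindex])
  have derG: "(G has_derivative G' x) (at x within T)" if "x \<in> T" for x
  proof -
    have "(g has_derivative g' (?P x)) (at (?P x))"
      using that by (intro der) (simp add: T_def)
    from bounded_linear.has_derivative [OF bl(2)
        has_derivative_compose [OF bounded_linear_imp_has_derivative [OF bl(1)] this]]
    show ?thesis
      unfolding G_def G'_def comp_def by (rule has_derivative_at_withinI)
  qed
  have injG: "inj_on G T"
  proof (rule inj_onI)
    fix x y assume "x \<in> T" "y \<in> T" "G x = G y"
    then have "?P (G x) = ?P (G y)" "?P x \<in> S" "?P y \<in> S"
      by (auto simp: T_def)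
    then have "?P x = ?P y"
      using inj by (simp add: G_def iv inj_on_def)
    then have "?Q (?P x) = ?Q (?P y)"
      by simp
    then show "x = y"
      by (simp add: iv)
  qed
  have img: "G ` T = ?P -` (g ` S)"
  proof (rule equalityI)
    show "?P -` (g ` S) \<subseteq> G ` T"
    proof
      fix y assume "y \<in> ?P -` (g ` S)"
      then obtain s where s: "s \<in> S" "?P y = g s" by auto
      then have "?Q (?P y) = G (?Q s)"
        by (simp add: G_def iv)
      moreover have "?Q s \<in> T"
        using s by (simp add: T_def iv)
      ultimately show "y \<in> G ` T"
        by (simp add: iv)
    qed
  qed (auto simp: G_def T_def iv)
  have ei: "e (inv_into UNIV e k) = k" for k
    using iv(1) by (metis comp_apply id_apply)
  \<comment> \<open>\<open>?P\<close> maps standard basis vectors to standard basis vectors, so the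
    Jacobian matrix of G is that of g with renamed indices.\<close>
  have det: "det (matrix (G' x)) = det (matrix (g' (?P x)))" for x
  proof -
    have "?P (axis b 1) = axis (e b) 1" for b
      by (auto simp: reindex_def axis_def vec_eq_iff inv_f_eq [OF bij_is_inj [OF e]] ei)
    then have "matrix (G' x) = (\<chi> a b. matrix (g' (?P x)) $ e a $ e b)"
      by (simp add: G'_def matrix_def vec_eq_iff reindex_def)
    then show ?thesis
      using det_reindex [OF e] by simp
  qed
  have fP: "set_integrable lebesgue (G ` T) (f \<circ> ?P)"
    unfolding img by (rule set_integral_reindex [OF bij f])
  note cv = change_of_variables_complex [OF _ derG injG fP]
  have eq: "(\<lambda>x. \<bar>det (matrix (G' x))\<bar> *\<^sub>R (f \<circ> ?P) (G x))
      = (\<lambda>x. \<bar>det (matrix (g' x))\<bar> *\<^sub>R f (g x)) \<circ> ?P"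
    by (simp add: fun_eq_iff det G_def iv)
  have Tl: "T \<in> sets lebesgue"
    using T by auto
  have QT: "?Q -` T = S"
    by (auto simp: T_def iv)
  have "set_lebesgue_integral lebesgue (?Q -` T) (((\<lambda>x. \<bar>det (matrix (g' x))\<bar> *\<^sub>R f (g x)) \<circ> ?P) \<circ> ?Q)
     = set_lebesgue_integral lebesgue T ((\<lambda>x. \<bar>det (matrix (g' x))\<bar> *\<^sub>R f (g x)) \<circ> ?P)"
    using set_integral_reindex(2) [OF e cv(1) [OF Tl]] unfolding eq .
  moreover have "((\<lambda>x. \<bar>det (matrix (g' x))\<bar> *\<^sub>R f (g x)) \<circ> ?P) \<circ> ?Q = (\<lambda>x. \<bar>det (matrix (g' x))\<bar> *\<^sub>R f (g x))"
    by (simp add: fun_eq_iff iv)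
  ultimately show ?thesis
    using cv(2) [OF Tl] set_integral_reindex(2) [OF bij f] unfolding eq img QT by simp
qed

text \<open>A copy of the pairs, made to carry the linear order given by the position in
  \<open>lexpairs\<close>. Positions are natural numbers, which provides the induction for
  \<open>wellorder\<close>.\<close>

typedef 'r lexpair = "UNIV :: ('r \<times> 'r) set"
  by blast

instance lexpair :: (finite) finite
proof
  have "(UNIV :: 'a lexpair set) = range Abs_lexpair"
    by (metis Rep_lexpair_inverse surjI)
  then show "finite (UNIV :: 'a lexpair set)"
    by (metis finite finite_imageI)
qed

instantiation lexpair :: ("{finite,wellorder}") wellorder
begin

definition less_eq_lexpair :: "'a lexpair \<Rightarrow> 'a lexpair \<Rightarrow> bool" where
  "p \<le> q \<longleftrightarrow> lexindex (Rep_lexpair p) \<le> lexindex (Rep_lexpair q)"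

definition less_lexpair :: "'a lexpair \<Rightarrow> 'a lexpair \<Rightarrow> bool" where
  "p < q \<longleftrightarrow> lexindex (Rep_lexpair p) < lexindex (Rep_lexpair q)"

instance
proof
  fix p q :: "'a lexpair" and P :: "'a lexpair \<Rightarrow> bool"
  show "p \<le> q \<Longrightarrow> q \<le> p \<Longrightarrow> p = q"
    unfolding less_eq_lexpair_def by (metis Rep_lexpair_inject lexindex(3) order_antisym)
  show "P p" if "\<And>p. (\<And>q. q < p \<Longrightarrow> P q) \<Longrightarrow> P p"
    using that unfolding less_lexpair_def
    by (induction p rule: measure_induct_rule [where f = "\<lambda>p. lexindex (Rep_lexpair p)"]) blast
qed (auto simp: less_eq_lexpair_def less_lexpair_def)

end

lemma bij_Rep_lexpair: "bij Rep_lexpair"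
proof (rule bijI)
  show "inj Rep_lexpair"
    by (simp add: inj_def Rep_lexpair_inject)
  show "surj Rep_lexpair"
    by (metis Abs_lexpair_inverse UNIV_I surjI)
qed

section \<open>Integration over a decomposed domain\<close>

text \<open>The sum over I is unordered and therefore needs absolute convergence: the partial sums
  of the norms are bounded by the integral of \<open>norm (f x)\<close> over the whole
  union.\<close>

lemma set_integral_infsum:
  fixes f :: "'a \<Rightarrow> 'b::{banach, second_countable_topology}"
  assumes I: "countable I" and disj: "disjoint_family_on A I" and A: "\<And>i. i \<in> I \<Longrightarrow> A i \<in> sets M"
    and f: "set_integrable M (\<Union>i\<in>I. A i) f"
  shows "(\<Sum>\<^sub>\<infinity>i\<in>I. set_lebesgue_integral M (A i) f) = set_lebesgue_integral M (\<Union>i\<in>I. A i) f"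
proof -
  let ?t = "to_nat_on I"
  define B where "B n = (if n \<in> ?t ` I then A (from_nat_into I n) else {})" for n
  have inj: "inj_on ?t I"
    using I by (rule inj_on_to_nat_on)
  have Bt: "B (?t i) = A i" if "i \<in> I" for i
    using that I by (simp add: B_def)
  have Bcases: "B n = {} \<or> (\<exists>i\<in>I. n = ?t i \<and> B n = A i)" for n
    using Bt by (cases "n \<in> ?t ` I") (auto simp: B_def)
  have U: "(\<Union>n. B n) = (\<Union>i\<in>I. A i)"
  proof (rule equalityI)
    show "(\<Union>n. B n) \<subseteq> (\<Union>i\<in>I. A i)"
      using Bcases by (metis UN_least UN_upper empty_subsetI)
    show "(\<Union>i\<in>I. A i) \<subseteq> (\<Union>n. B n)"
      using Bt by blast
  qed
  have sets: "B n \<in> sets M" for n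
    using Bcases [of n] A by auto
  have Bdisj: "B m \<inter> B n = {}" if "m \<noteq> n" for m n
    using Bcases [of m] Bcases [of n] disj that unfolding disjoint_family_on_def by (metis Int_empty_left Int_empty_right)
  let ?J = "\<lambda>n. set_lebesgue_integral M (B n) f"
  have intU: "set_integrable M (\<Union>n. B n) f"
    using f by (simp only: U)
  have intB: "set_integrable M (B n) f" for n
    by (rule set_integrable_subset [OF intU]) (use sets in auto)
  have norm_le: "norm (?J n) \<le> set_lebesgue_integral M (B n) (\<lambda>x. norm (f x))" for n
  proof -
    have "norm (?J n) \<le> (LINT x|M. norm (indicator (B n) x *\<^sub>R f x))"
      unfolding set_lebesgue_integral_def by (rule integral_norm_bound)
    also have "\<dots> = set_lebesgue_integral M (B n) (\<lambda>x. norm (f x))"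
      unfolding set_lebesgue_integral_def by (intro Bochner_Integration.integral_cong) auto
    finally show ?thesis .
  qed
  have sm: "summable (\<lambda>n. norm (?J n))"
  proof (rule summableI_nonneg_bounded)
    fix n
    have "(\<Sum>i<n. norm (?J i)) \<le> (\<Sum>i<n. set_lebesgue_integral M (B i) (\<lambda>x. norm (f x)))"
      by (intro sum_mono norm_le)
    also have "\<dots> = set_lebesgue_integral M (\<Union>i<n. B i) (\<lambda>x. norm (f x))"
      by (rule set_integral_finite_Union [symmetric])
        (auto simp: disjoint_family_on_def Bdisj sets intro: set_integrable_norm intB)
    also have "\<dots> \<le> set_lebesgue_integral M (\<Union>n. B n) (\<lambda>x. norm (f x))"
      unfolding set_lebesgue_integral_def
    proof (rule integral_mono)
      show "integrable M (\<lambda>x. indicator (\<Union>n. B n) x *\<^sub>R norm (f x))"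
        using set_integrable_norm [OF intU] by (simp add: set_integrable_def)
      have "set_integrable M (\<Union>i<n. B i) (\<lambda>x. norm (f x))"
        by (rule set_integrable_subset [OF set_integrable_norm [OF intU]]) (use sets in auto)
      then show "integrable M (\<lambda>x. indicator (\<Union>i<n. B i) x *\<^sub>R norm (f x))"
        by (simp add: set_integrable_def)
    qed (auto simp: indicator_def)
    finally show "(\<Sum>i<n. norm (?J i)) \<le> set_lebesgue_integral M (\<Union>n. B n) (\<lambda>x. norm (f x))" .
  qed simp
  have "?J sums set_lebesgue_integral M (\<Union>n. B n) f"
    using summable_sums [OF summable_norm_cancel [OF sm]]
      lebesgue_integral_countable_add [OF sets Bdisj intU] by simp
  with sm have "(?J has_sum set_lebesgue_integral M (\<Union>n. B n) f) UNIV"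
    by (rule norm_summable_imp_has_sum)
  then have "infsum ?J UNIV = set_lebesgue_integral M (\<Union>i\<in>I. A i) f"
    unfolding U by (rule infsumI)
  moreover have "infsum ?J UNIV = infsum ?J (?t ` I)"
    by (rule infsum_cong_neutral) (auto simp: B_def set_lebesgue_integral_def)
  moreover have "infsum ?J (?t ` I) = infsum (?J \<circ> ?t) I"
    by (rule infsum_reindex [OF inj])
  moreover have "infsum (?J \<circ> ?t) I = (\<Sum>\<^sub>\<infinity>i\<in>I. set_lebesgue_integral M (A i) f)"
    by (rule infsum_cong) (simp add: Bt)
  ultimately show ?thesis
    by simp
qed

text \<open>A directional derivative is the pointwise limit of difference quotients with steps 1 /
  (n + 1), and each of these is Borel measurable.\<close>

lemma borel_measurable_has_derivative:
  fixes g :: "'a::euclidean_space \<Rightarrow> 'b::euclidean_space"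
  assumes U: "open U" and der: "\<And>s. s \<in> U \<Longrightarrow> (g has_derivative g' s) (at s)"
  shows "(\<lambda>s. indicator U s *\<^sub>R g' s v) \<in> borel_measurable borel"
proof -
  \<comment> \<open>Extension by 0 makes the difference quotients functions on the whole space. For
    fixed s in the open set U the shifted points eventually lie in U, where h agrees with g.\<close>
  define h where "h s = indicator U s *\<^sub>R g s" for s
  have "continuous_on U g"
    using der by (meson continuous_at_imp_continuous_on has_derivative_continuous)
  then have h: "h \<in> borel_measurable borel"
    unfolding h_def [abs_def] using U by (intro borel_measurable_continuous_on_indicator) auto
  define q where "q n s = indicator U s *\<^sub>R (real (Suc n) *\<^sub>R (h (s + (1 / real (Suc n)) *\<^sub>R v) - h s))" for n s
  have q: "q n \<in> borel_measurable borel" for n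
  proof -
    have "(\<lambda>s. s + (1 / real (Suc n)) *\<^sub>R v) \<in> borel_measurable borel"
      by (intro borel_measurable_continuous_onI continuous_intros)
    from measurable_compose [OF this h] show ?thesis
      unfolding q_def [abs_def] using U h
      by (intro borel_measurable_scaleR borel_measurable_diff borel_measurable_indicator
          borel_measurable_const) auto
  qed
  have "(\<lambda>n. q n s) \<longlonglongrightarrow> indicator U s *\<^sub>R g' s v" for s
  proof (cases "s \<in> U")
    case True
    let ?t = "\<lambda>n. 1 / real (Suc n)"
    have t0: "?t \<longlonglongrightarrow> 0"
      by (intro LIMSEQ_Suc lim_1_over_n)
    have "((\<lambda>t. g (s + t *\<^sub>R v)) has_derivative (\<lambda>t. g' s (t *\<^sub>R v))) (at 0)"
    proof -
      have "((\<lambda>t. s + t *\<^sub>R v) has_derivative (\<lambda>t. t *\<^sub>R v)) (at 0)"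
        by (auto intro!: derivative_eq_intros)
      moreover have "(g has_derivative g' s) (at (s + 0 *\<^sub>R v))"
        using der [OF True] by simp
      ultimately show ?thesis
        by (rule has_derivative_compose)
    qed
    then have "((\<lambda>t. g (s + t *\<^sub>R v)) has_derivative (\<lambda>t. t *\<^sub>R g' s v)) (at 0)"
      using linear_scale [OF has_derivative_linear [OF der [OF True]]] by simp
    then have "((\<lambda>t. norm (g (s + t *\<^sub>R v) - g s - t *\<^sub>R g' s v) / norm t) \<longlongrightarrow> 0) (at 0)"
      by (simp add: has_derivative_at)
    then have lim0: "(\<lambda>n. norm (g (s + ?t n *\<^sub>R v) - g s - ?t n *\<^sub>R g' s v) / norm (?t n)) \<longlonglongrightarrow> 0"
      by (rule filterlim_compose) (use t0 in \<open>auto intro!: filterlim_atI\<close>)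
    have quot: "norm (g (s + t *\<^sub>R v) - g s - t *\<^sub>R g' s v) / norm t
        = norm ((1 / t) *\<^sub>R (g (s + t *\<^sub>R v) - g s) - g' s v)" if "t > 0" for t
    proof -
      have "(1 / t) *\<^sub>R (g (s + t *\<^sub>R v) - g s) - g' s v = (1 / t) *\<^sub>R (g (s + t *\<^sub>R v) - g s - t *\<^sub>R g' s v)"
        using that by (simp add: scaleR_diff_right)
      then show ?thesis
        using that by simp
    qed
    have "0 < ?t n" for n
      by simp
    then have "(\<lambda>n. norm ((1 / ?t n) *\<^sub>R (g (s + ?t n *\<^sub>R v) - g s) - g' s v)) \<longlonglongrightarrow> 0"
      using lim0 by (simp only: quot)
    then have lim: "(\<lambda>n. (1 / ?t n) *\<^sub>R (g (s + ?t n *\<^sub>R v) - g s)) \<longlonglongrightarrow> g' s v"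
      by (rule LIM_zero_cancel [OF tendsto_norm_zero_cancel])
    have "(\<lambda>n. s + ?t n *\<^sub>R v) \<longlonglongrightarrow> s + 0 *\<^sub>R v"
      by (intro tendsto_intros t0)
    then have "\<forall>\<^sub>F n in sequentially. s + ?t n *\<^sub>R v \<in> U"
      using U True by (simp add: topological_tendstoD)
    then have "\<forall>\<^sub>F n in sequentially. (1 / ?t n) *\<^sub>R (g (s + ?t n *\<^sub>R v) - g s) = q n s"
      by eventually_elim (simp add: q_def h_def True)
    with lim show ?thesis
      using True by (simp add: Lim_transform_eventually)
  qed (simp add: q_def)
  then show ?thesis
    by (rule borel_measurable_LIMSEQ_metric [OF q])
qed

lemma borel_measurable_det:
  fixes A :: "'a \<Rightarrow> real^'n^'n"
  assumes "\<And>i j. (\<lambda>x. A x $ i $ j) \<in> borel_measurable M"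
  shows "(\<lambda>x. det (A x)) \<in> borel_measurable M"
  unfolding det_def by (intro borel_measurable_sum borel_measurable_times borel_measurable_const borel_measurable_prod assms)

lemma set_integrable_lebesgue:
  fixes f :: "'a::euclidean_space \<Rightarrow> 'b::{banach, second_countable_topology}"
  assumes "set_integrable lborel S f"
  shows "set_integrable lebesgue S f"
  using assms integrable_completion [of "\<lambda>x. indicator S x *\<^sub>R f x" lborel] unfolding set_integrable_def
  by (simp add: borel_measurable_integrable)

text \<open>Completing the measure does not change the integral of a Borel function; this is the
  bridge between the change of variables and the integrals in the definitions.\<close>

lemma set_integral_lebesgue:
  fixes f :: "'a::euclidean_space \<Rightarrow> 'b::{banach, second_countable_topology}"
  assumes "(\<lambda>x. indicator S x *\<^sub>R f x) \<in> borel_measurable borel"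
  shows "set_lebesgue_integral lebesgue S f = set_lebesgue_integral lborel S f"
  unfolding set_lebesgue_integral_def by (rule integral_completion) (use assms in simp)

text \<open>In the coordinates \<open>hcoord\<close> the Jacobian determinant of a simplex is
  exactly \<open>dU_form\<close> of its tangent vectors. By the orientation required in
  \<open>is_domain_chain\<close> it is positive, so it agrees with the absolute value in the change
  of variables.\<close>

lemma integral_domain_chain:
  fixes z :: "'r::{finite,wellorder} zblock list"
  assumes chain: "twisted_chain \<mu> \<alpha> z C" and \<mu>: "\<mu> \<noteq> []" and z0: "z ! 0 = vcat (mat 1) 0"
    and herm: "in_hermitian C" and dom: "is_domain_chain C D f" and int: "herm_integrable D f"
    and D: "\<And>U. U \<in> D \<Longrightarrow> hermitian U"
  shows "(\<Sum>\<^sub>\<infinity>\<sigma>\<in>csupp C. set_lebesgue_integral lborel open_spx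
            (\<lambda>s. C \<sigma> (bary s) (affpt (spx_u \<sigma> s)) * of_real (dU_form (spx_tangent \<sigma> s))))
       = herm_integral D f"
proof -
  let ?K = "closed_spx :: (real^('r \<times> 'r)) set" and ?O = "open_spx :: (real^('r \<times> 'r)) set"
  define g where "g \<sigma> s = hcoord (spx_u \<sigma> s)" for \<sigma> :: "'r spx" and s
  define F where "F v = f (hmat v)" for v
  define A where "A \<sigma> = g \<sigma> ` ?O" for \<sigma>
  define DD where "DD = {v. hmat v \<in> D}"
  have bl: "bounded_linear (hcoord :: 'r cmat \<Rightarrow> _)"
    by (rule linear_conv_bounded_linear [THEN iffD1, OF linear_hcoord])
  have F: "set_integrable lborel DD F"
    using int unfolding herm_integrable_def DD_def F_def .
  have hg: "hmat (g \<sigma> s) = spx_u \<sigma> s" if "\<sigma> \<in> csupp C" "s \<in> ?K" for \<sigma> s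
    unfolding g_def by (intro hmat_hcoord in_hermitian_spx_u [OF herm that])
  note OK = subsetD [OF open_spx_subset]
  have d1: "inj_on (spx_u \<sigma>) ?O" "\<And>s. s \<in> ?O \<Longrightarrow> 0 < dU_form (spx_tangent \<sigma> s)"
    "\<And>s. s \<in> ?K \<Longrightarrow> C \<sigma> (bary s) (affpt (spx_u \<sigma> s)) = f (spx_u \<sigma> s)" if "\<sigma> \<in> csupp C" for \<sigma>
    using dom that unfolding is_domain_chain_def by blast+
  have d2: "disjnt (spx_u \<sigma> ` ?O) (spx_u \<sigma>' ` ?O)" if "\<sigma> \<in> csupp C" "\<sigma>' \<in> csupp C" "\<sigma> \<noteq> \<sigma>'" for \<sigma> \<sigma>'
    using dom that unfolding is_domain_chain_def pairwise_def by blast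
  have d3: "(\<Union>\<sigma>\<in>csupp C. spx_u \<sigma> ` ?K) = D"
    using dom unfolding is_domain_chain_def by blast
  have inj: "inj_on (g \<sigma>) ?O" if "\<sigma> \<in> csupp C" for \<sigma>
    using d1(1) [OF that] hg [OF that] OK unfolding inj_on_def by metis
  have diff: "g \<sigma> differentiable_on ?K" if "\<sigma> \<in> csupp C" for \<sigma>
    unfolding g_def [abs_def]
    by (rule differentiable_on_bounded_linear [OF bl spx_u_differentiable [OF chain that \<mu> z0]])
  define g' where "g' \<sigma> s v = hcoord (frechet_derivative (spx_u \<sigma>) (at s) v)" for \<sigma> :: "'r spx" and s v
  have der: "(g \<sigma> has_derivative g' \<sigma> s) (at s)" if "\<sigma> \<in> csupp C" "s \<in> ?O" for \<sigma> s
    unfolding g_def [abs_def] g'_def [abs_def]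
    by (rule bounded_linear.has_derivative [OF bl spx_u_has_derivative [OF chain that(1) \<mu> z0 that(2)]])
  have mat: "matrix (g' \<sigma> s) = (\<chi> p q. hcoord (spx_tangent \<sigma> s q) $ p)" for \<sigma> s
    by (simp add: matrix_def g'_def spx_tangent_def)
  have det: "det (matrix (g' \<sigma> s)) = dU_form (spx_tangent \<sigma> s)" for \<sigma> s
    unfolding mat dU_form_def ..
  \<comment> \<open>Invariance of domain: g \<sigma> is continuous and injective on an open set,
    into a space of the same dimension. Openness gives both the measurability of the pieces and the
    countability of their family.\<close>
  have openA: "open (A \<sigma>)" if "\<sigma> \<in> csupp C" for \<sigma>
    unfolding A_def using differentiable_imp_continuous_on [OF diff [OF that]] continuous_on_subset open_spx_subset
    by (intro invariance_of_domain inj that open_open_spx) blast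
  have AD: "A \<sigma> \<subseteq> DD" if "\<sigma> \<in> csupp C" for \<sigma>
  proof -
    have "hmat (g \<sigma> s) \<in> D" if "s \<in> ?O" for s
      using hg [OF \<open>\<sigma> \<in> csupp C\<close> OK [OF that]] d3 \<open>\<sigma> \<in> csupp C\<close> OK [OF that] by auto
    then show ?thesis
      by (auto simp: A_def DD_def)
  qed
  have disjA: "A \<sigma> \<inter> A \<sigma>' = {}" if "\<sigma> \<in> csupp C" "\<sigma>' \<in> csupp C" "\<sigma> \<noteq> \<sigma>'" for \<sigma> \<sigma>'
  proof (rule ccontr)
    assume "A \<sigma> \<inter> A \<sigma>' \<noteq> {}"
    then obtain s s' where s: "s \<in> ?O" "s' \<in> ?O" "g \<sigma> s = g \<sigma>' s'"
      unfolding A_def by blast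
    then have "spx_u \<sigma> s = spx_u \<sigma>' s'"
      using hg that OK by metis
    then show False
      using d2 [OF that] s(1,2) unfolding disjnt_def by blast
  qed
  \<comment> \<open>A disjoint family of open sets is countable, and \<sigma> is recovered from
    \<open>A \<sigma>\<close> since a nonempty set is not disjoint from itself.\<close>
  have countable: "countable (csupp C)"
  proof (rule countable_image_inj_on)
    show "countable (A ` csupp C)"
    proof (rule countable_disjoint_open_subsets)
      show "pairwise disjnt (A ` csupp C)"
        using disjA unfolding pairwise_def disjnt_def by blast
    qed (use openA in auto)
    have "A \<sigma> \<noteq> {}" for \<sigma>
      using open_spx_nonempty by (simp add: A_def)
    then show "inj_on A (csupp C)"
      using disjA unfolding inj_on_def by (metis Int_absorb)
  qed
  have J: "set_lebesgue_integral lborel ?O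
      (\<lambda>s. C \<sigma> (bary s) (affpt (spx_u \<sigma> s)) * of_real (dU_form (spx_tangent \<sigma> s)))
      = set_lebesgue_integral lborel (A \<sigma>) F" if \<sigma>: "\<sigma> \<in> csupp C" for \<sigma>
  proof -
    have FA: "set_integrable lborel (A \<sigma>) F"
      by (rule set_integrable_subset [OF F _ AD [OF \<sigma>]]) (use openA [OF \<sigma>] in auto)
    have bF: "(\<lambda>v. indicator (A \<sigma>) v *\<^sub>R F v) \<in> borel_measurable borel"
      using borel_measurable_integrable [OF FA [unfolded set_integrable_def]] by simp
    have bg: "(\<lambda>s. indicator ?O s *\<^sub>R g \<sigma> s) \<in> borel_measurable borel"
      by (rule borel_measurable_continuous_on_indicator [OF borel_open [OF open_open_spx]
            continuous_on_subset [OF differentiable_imp_continuous_on [OF diff [OF \<sigma>]] open_spx_subset]])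
    have bdet: "(\<lambda>s. det (\<chi> p q. (indicator ?O s *\<^sub>R g' \<sigma> s (axis q 1)) $ p)) \<in> borel_measurable borel"
    proof (rule borel_measurable_det)
      fix p q
      have "(\<lambda>s. (indicator ?O s *\<^sub>R g' \<sigma> s (axis q 1)) \<bullet> axis p 1) \<in> borel_measurable borel"
        by (intro borel_measurable_inner borel_measurable_const
            borel_measurable_has_derivative [OF open_open_spx der [OF \<sigma>]])
      then show "(\<lambda>s. (\<chi> p q. (indicator ?O s *\<^sub>R g' \<sigma> s (axis q 1)) $ p) $ p $ q) \<in> borel_measurable borel"
        by (simp add: inner_axis)
    qed
    let ?h = "\<lambda>s. indicator ?O s *\<^sub>R (\<bar>det (matrix (g' \<sigma> s))\<bar> *\<^sub>R F (g \<sigma> s))"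
    \<comment> \<open>Outside the open simplex, g and its derivative are replaced by 0, which the
      outer indicator hides; on it the inserted indicators are 1. Every factor is now a Borel
      function on the whole space.\<close>
    have h_eq: "?h = (\<lambda>s. indicator ?O s *\<^sub>R (\<bar>det (\<chi> p q. (indicator ?O s *\<^sub>R g' \<sigma> s (axis q 1)) $ p)\<bar> *\<^sub>R
        (indicator (A \<sigma>) (indicator ?O s *\<^sub>R g \<sigma> s) *\<^sub>R F (indicator ?O s *\<^sub>R g \<sigma> s))))"
      by (auto simp: fun_eq_iff indicator_def A_def matrix_def)
    have bh: "?h \<in> borel_measurable borel"
      unfolding h_eq
      by (intro borel_measurable_scaleR borel_measurable_abs bdet measurable_compose [OF bg bF]
          borel_measurable_indicator borel_open open_open_spx)
    have "set_lebesgue_integral lebesgue ?O (\<lambda>s. \<bar>det (matrix (g' \<sigma> s))\<bar> *\<^sub>R F (g \<sigma> s))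
        = set_lebesgue_integral lebesgue (g \<sigma> ` ?O) F"
      using set_integrable_lebesgue [OF FA]
      by (intro change_of_variables_reindex [OF bij_Rep_lexpair open_open_spx der [OF \<sigma>] inj [OF \<sigma>]])
        (auto simp: A_def)
    then have "set_lebesgue_integral lborel ?O (\<lambda>s. \<bar>det (matrix (g' \<sigma> s))\<bar> *\<^sub>R F (g \<sigma> s))
        = set_lebesgue_integral lborel (A \<sigma>) F"
      using set_integral_lebesgue [OF bF] set_integral_lebesgue [OF bh] by (simp add: A_def)
    moreover have "indicator ?O s *\<^sub>R (\<bar>det (matrix (g' \<sigma> s))\<bar> *\<^sub>R F (g \<sigma> s))
       = indicator ?O s *\<^sub>R (C \<sigma> (bary s) (affpt (spx_u \<sigma> s)) * of_real (dU_form (spx_tangent \<sigma> s)))" for s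
    proof (cases "s \<in> ?O")
      case True
      then show ?thesis
        using d1(2) [OF \<sigma> True] d1(3) [OF \<sigma> OK [OF True]] hg [OF \<sigma> OK [OF True]]
        by (simp add: det F_def scaleR_conv_of_real mult.commute)
    qed simp
    ultimately show ?thesis
      unfolding set_lebesgue_integral_def by simp
  qed
  let ?A = "\<Union>\<sigma>\<in>csupp C. A \<sigma>"
  have FA: "set_integrable lborel ?A F"
  proof (rule set_integrable_subset [OF F])
    have "open ?A"
      using openA by (intro open_UN) blast
    then show "?A \<in> sets lborel"
      by simp
    show "?A \<subseteq> DD"
      using AD by blast
  qed
  \<comment> \<open>The images of the faces: a differentiable map between spaces of equal dimension
    preserves null sets, and there are countably many simplices.\<close>
  have "negligible (\<Union>\<sigma>\<in>csupp C. g \<sigma> ` (?K - ?O))"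
  proof (rule negligible_countable_Union)
    show "countable ((\<lambda>\<sigma>. g \<sigma> ` (?K - ?O)) ` csupp C)"
      using countable by simp
    fix S assume "S \<in> (\<lambda>\<sigma>. g \<sigma> ` (?K - ?O)) ` csupp C"
    then obtain \<sigma> where \<sigma>: "\<sigma> \<in> csupp C" "S = g \<sigma> ` (?K - ?O)" by blast
    show "negligible S"
      unfolding \<sigma>(2)
      by (intro negligible_differentiable_image_negligible negligible_spx_boundary
          differentiable_on_subset [OF diff [OF \<sigma>(1)]]) auto
  qed
  moreover have "DD - ?A \<subseteq> (\<Union>\<sigma>\<in>csupp C. g \<sigma> ` (?K - ?O))"
  proof
    fix v assume v: "v \<in> DD - ?A"
    then obtain \<sigma> s where \<sigma>: "\<sigma> \<in> csupp C" "s \<in> ?K" "hmat v = spx_u \<sigma> s"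
      using d3 unfolding DD_def by blast
    then have vg: "v = g \<sigma> s"
      unfolding g_def by (metis hcoord_hmat)
    with v \<sigma> have "s \<notin> ?O"
      unfolding A_def by blast
    with vg \<sigma> show "v \<in> (\<Union>\<sigma>\<in>csupp C. g \<sigma> ` (?K - ?O))"
      by blast
  qed
  ultimately have "DD - ?A \<in> null_sets lebesgue"
    using negligible_subset negligible_iff_null_sets by blast
  then have "AE v in lebesgue. v \<notin> DD - ?A"
    by (rule AE_not_in)
  then have "AE v in lborel. v \<notin> DD - ?A"
    by (simp add: AE_completion_iff)
  then have ae: "AE v in lborel. indicator ?A v *\<^sub>R F v = indicator DD v *\<^sub>R F v"
    by eventually_elim (use AD in \<open>auto simp: indicator_def\<close>)
  have "(\<Sum>\<^sub>\<infinity>\<sigma>\<in>csupp C. set_lebesgue_integral lborel (A \<sigma>) F) = set_lebesgue_integral lborel ?A F"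
    by (rule set_integral_infsum [OF countable _ _ FA])
      (use disjA openA in \<open>auto simp: disjoint_family_on_def\<close>)
  also have "\<dots> = set_lebesgue_integral lborel DD F"
    unfolding set_lebesgue_integral_def
    by (rule integral_cong_AE) (use FA F ae in \<open>auto simp: set_integrable_def dest: borel_measurable_integrable\<close>)
  finally show ?thesis
    using J by (simp add: herm_integral_def DD_def F_def [abs_def] cong: infsum_cong)
qed

section \<open>The theorem\<close>

lemma x_mat_0:
  "x_mat [1, 1, 1, 1] x ! 0 = vcat (mat 1) 0" "x_mat [2, 1, 1] x ! 0 = vcat (mat 1) 0"
  "x_mat [2, 2] x ! 0 = vcat (mat 1) 0" "x_mat [3, 1] x ! 0 = vcat (mat 1) 0"
  "x_mat [4] x ! 0 = vcat (mat 1) 0"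
  by (simp_all add: x_mat_simps del: One_nat_def)

lemma chart_values_gauss:
  "chart_values [1, 1, 1, 1] [\<alpha>, p, q, s] (x_mat [1, 1, 1, 1] x) u \<subseteq>
     mpow (det u) p * mpow (det (mat 1 - u)) q * mpow (det (mat 1 - u ** x)) s"
  using chart_values_1111 [of "[\<alpha>, p, q, s]" x u] by simp

lemma chart_values_kummer:
  "chart_values [2, 1, 1] [\<alpha>, 1, p, q] (x_mat [2, 1, 1] x) u \<subseteq>
     {etr (u ** x)} * mpow (det u) p * mpow (det (mat 1 - u)) q"
  using chart_values_211 [of "[\<alpha>, 1, p, q]" x u] by (simp add: etr_def)

lemma chart_values_bessel:
  "chart_values [2, 2] [\<alpha>, 1, p, - 1] (x_mat [2, 2] x) u \<subseteq>
     {etr (u ** x - matrix_inv u)} * mpow (det u) p"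
proof -
  have "{exp (trace (u ** x))} * mpow (det u) p * {exp (- trace (matrix_inv u))}
      = {exp (trace (u ** x))} * {exp (- trace (matrix_inv u))} * mpow (det u) p"
    by (simp only: mult.assoc mult.commute [of "mpow (det u) p"])
  also have "{exp (trace (u ** x))} * {exp (- trace (matrix_inv u))} = {etr (u ** x - matrix_inv u)}"
    by (simp add: set_times_def etr_def trace_sub exp_diff exp_minus divide_inverse)
  finally show ?thesis
    using chart_values_22 [of "[\<alpha>, 1, p, - 1]" x u] by simp
qed

lemma chart_values_hermite_weber:
  "chart_values [3, 1] [\<alpha>, 0, 1, p] (x_mat [3, 1] x) u \<subseteq>
     {etr (u ** x - (1/2) *\<^sub>R (u ** u))} * mpow (det u) p"
  using chart_values_31 [of "[\<alpha>, 0, 1, p]" x u] by (simp add: etr_def)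

lemma chart_values_airy:
  "chart_values [4] [\<alpha>, 0, 0, 1] (x_mat [4] x) u \<subseteq> {etr (u ** x + (1/3) *\<^sub>R (u ** u ** u))}"
  using chart_values_4 [of "[\<alpha>, 0, 0, 1]" x u] by (simp add: etr_def)

text \<open>The logarithm yields u^3 / 3 where the Airy integrand has - u^3 / 3. Reversing the signs
  of the last parameter and of x together changes only the cubic term.\<close>

lemma chart_values_airy_minus:
  "chart_values [4] [\<alpha>, 0, 0, - 1] (x_mat [4] (- x)) u \<subseteq> {etr (u ** x - (1/3) *\<^sub>R (u ** u ** u))}"
proof -
  have "- trace (u ** (- x) + (1/3) *\<^sub>R (u ** u ** u)) = trace (u ** x - (1/3) *\<^sub>R (u ** u ** u))"
    by (simp add: mult_minus_right trace_add trace_sub trace_uminus)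
  then show ?thesis
    using chart_values_4 [of "[\<alpha>, 0, 0, - 1]" "- x" u] by (simp add: etr_def)
qed

lemma radon_hgf_gauss_domain:
  fixes C :: "'r::{finite,wellorder} tchain" and X :: "'r cmat"
  defines "\<kappa> \<equiv> det (herm_entry :: complex^('r \<times> 'r)^('r \<times> 'r))"
  assumes chain: "twisted_chain [1, 1, 1, 1] \<alpha> (x_mat [1, 1, 1, 1] X) C" and herm: "in_hermitian C"
    and dom: "is_domain_chain C unit_domain (gauss_integrand a b c X)"
    and int: "herm_integrable unit_domain (gauss_integrand a b c X)"
  shows "radon_hgf [1, 1, 1, 1] (x_mat [1, 1, 1, 1] X) \<alpha> C = \<kappa> * herm_integral unit_domain (gauss_integrand a b c X)"
    and "hermitian_gauss a b c X = Gamma_r TYPE('r) c / (Gamma_r TYPE('r) a * Gamma_r TYPE('r) (c - a)) / \<kappa> *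
           radon_hgf [1, 1, 1, 1] (x_mat [1, 1, 1, 1] X) \<alpha> C"
proof -
  \<comment> \<open>\<open>chart_values\<close> itself serves as the integrand, since only the
    number y is wanted: \<open>has_dU_integral\<close> fixes it as the sum of the simplex integrals,
    which \<open>integral_domain_chain\<close> evaluates.\<close>
  obtain y where y: "has_dU_integral (chart_values [1, 1, 1, 1] \<alpha> (x_mat [1, 1, 1, 1] X)) C y"
    "radon_hgf [1, 1, 1, 1] (x_mat [1, 1, 1, 1] X) \<alpha> C = \<kappa> * y"
    using has_dU_integral_radon_hgf [OF chain _ x_mat_0(1) order_refl herm du_form_hermitian]
    unfolding \<kappa>_def by blast
  have "hermitian U" if "U \<in> unit_domain" for U :: "'r cmat"
    using that by (auto simp: unit_domain_def posdef_def)
  then have "y = herm_integral unit_domain (gauss_integrand a b c X)"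
    using y(1) integral_domain_chain [OF chain _ x_mat_0(1) herm dom int]
    unfolding has_dU_integral_def by simp
  with y(2) show F: "radon_hgf [1, 1, 1, 1] (x_mat [1, 1, 1, 1] X) \<alpha> C
      = \<kappa> * herm_integral unit_domain (gauss_integrand a b c X)"
    by simp
  show "hermitian_gauss a b c X = Gamma_r TYPE('r) c / (Gamma_r TYPE('r) a * Gamma_r TYPE('r) (c - a)) / \<kappa> *
           radon_hgf [1, 1, 1, 1] (x_mat [1, 1, 1, 1] X) \<alpha> C"
    unfolding F hermitian_gauss_def using det_herm_entry [where 'r = 'r] by (simp add: \<kappa>_def)
qed

theorem mainTheorem2:
  "(\<forall>(x :: 'r::{finite,wellorder} cmat) \<alpha> C.
      (admissible [1, 1, 1, 1] \<alpha> x \<and> twisted_cycle [1, 1, 1, 1] \<alpha> (x_mat [1, 1, 1, 1] x) C \<longrightarrow>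
        has_du_integral
          (\<lambda>u. mpow (det u) (\<alpha> ! 1) * mpow (det (mat 1 - u)) (\<alpha> ! 2) * mpow (det (mat 1 - u ** x)) (\<alpha> ! 3))
          C (radon_hgf [1, 1, 1, 1] (x_mat [1, 1, 1, 1] x) \<alpha> C)) \<and>
      (admissible [2, 1, 1] \<alpha> x \<and> twisted_cycle [2, 1, 1] \<alpha> (x_mat [2, 1, 1] x) C \<longrightarrow>
        has_du_integral
          (\<lambda>u. {exp (\<alpha> ! 1 * trace (u ** x))} * mpow (det u) (\<alpha> ! 2) * mpow (det (mat 1 - u)) (\<alpha> ! 3))
          C (radon_hgf [2, 1, 1] (x_mat [2, 1, 1] x) \<alpha> C)) \<and>
      (admissible [2, 2] \<alpha> x \<and> twisted_cycle [2, 2] \<alpha> (x_mat [2, 2] x) C \<longrightarrow>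
        has_du_integral
          (\<lambda>u. {exp (\<alpha> ! 1 * trace (u ** x))} * mpow (det u) (\<alpha> ! 2) * {exp (\<alpha> ! 3 * trace (matrix_inv u))})
          C (radon_hgf [2, 2] (x_mat [2, 2] x) \<alpha> C)) \<and>
      (admissible [3, 1] \<alpha> x \<and> twisted_cycle [3, 1] \<alpha> (x_mat [3, 1] x) C \<longrightarrow>
        has_du_integral
          (\<lambda>u. {exp (\<alpha> ! 1 * trace u + \<alpha> ! 2 * trace (u ** x - (1/2) *\<^sub>R (u ** u)))} * mpow (det u) (\<alpha> ! 3))
          C (radon_hgf [3, 1] (x_mat [3, 1] x) \<alpha> C)) \<and>
      (admissible [4] \<alpha> x \<and> twisted_cycle [4] \<alpha> (x_mat [4] x) C \<longrightarrow>
        has_du_integral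
          (\<lambda>u. {exp (\<alpha> ! 1 * trace u + \<alpha> ! 2 * trace (- (1/2) *\<^sub>R (u ** u)) +
                     \<alpha> ! 3 * trace (u ** x + (1/3) *\<^sub>R (u ** u ** u)))})
          C (radon_hgf [4] (x_mat [4] x) \<alpha> C)))
   \<and>
   (subspace {U :: 'r cmat. hermitian U} \<and>
    dim {U :: 'r cmat. hermitian U} = CARD('r) * CARD('r) \<and>
    (\<forall>M :: 'r cmat. \<exists>!(A, B). hermitian A \<and> hermitian B \<and> M = A + mat \<i> ** B))
   \<and>
   (\<exists>\<kappa> :: complex. \<kappa> \<noteq> 0 \<and>
      (\<forall>V :: 'r \<times> 'r \<Rightarrow> 'r cmat. (\<forall>q. hermitian (V q)) \<longrightarrow>
         du_form V = \<kappa> * of_real (dU_form V)) \<and>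
      (\<forall>(X :: 'r cmat) C. hermitian X \<and> in_hermitian C \<longrightarrow>
        (\<forall>\<alpha>1 a b c.
          (let \<alpha> = [\<alpha>1, a - of_nat CARD('r), c - a - of_nat CARD('r), - b];
               F = radon_hgf [1, 1, 1, 1] (x_mat [1, 1, 1, 1] X) \<alpha> C in
           admissible [1, 1, 1, 1] \<alpha> X \<and> twisted_chain [1, 1, 1, 1] \<alpha> (x_mat [1, 1, 1, 1] X) C \<longrightarrow>
             (\<exists>y. has_dU_integral
                (\<lambda>U. mpow (det U) (a - of_nat CARD('r)) * mpow (det (mat 1 - U)) (c - a - of_nat CARD('r)) *
                     mpow (det (mat 1 - U ** X)) (- b)) C y \<and> F = \<kappa> * y) \<and>
             (is_domain_chain C unit_domain (gauss_integrand a b c X) \<and>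
              herm_integrable unit_domain (gauss_integrand a b c X) \<longrightarrow>
                F = \<kappa> * herm_integral unit_domain (gauss_integrand a b c X) \<and>
                hermitian_gauss a b c X =
                  Gamma_r TYPE('r) c / (Gamma_r TYPE('r) a * Gamma_r TYPE('r) (c - a)) / \<kappa> * F))) \<and>
        (\<forall>\<alpha>1 a c.
          (let \<alpha> = [\<alpha>1, 1, a - of_nat CARD('r), c - a - of_nat CARD('r)] in
           admissible [2, 1, 1] \<alpha> X \<and> twisted_chain [2, 1, 1] \<alpha> (x_mat [2, 1, 1] X) C \<longrightarrow>
             (\<exists>y. has_dU_integral
                (\<lambda>U. {etr (U ** X)} * mpow (det U) (a - of_nat CARD('r)) *
                     mpow (det (mat 1 - U)) (c - a - of_nat CARD('r))) C y \<and>
                radon_hgf [2, 1, 1] (x_mat [2, 1, 1] X) \<alpha> C = \<kappa> * y))) \<and>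
        (\<forall>\<alpha>1 c.
          (let \<alpha> = [\<alpha>1, 1, c - of_nat CARD('r), - 1] in
           admissible [2, 2] \<alpha> X \<and> twisted_chain [2, 2] \<alpha> (x_mat [2, 2] X) C \<longrightarrow>
             (\<exists>y. has_dU_integral
                (\<lambda>U. {etr (U ** X - matrix_inv U)} * mpow (det U) (c - of_nat CARD('r))) C y \<and>
                radon_hgf [2, 2] (x_mat [2, 2] X) \<alpha> C = \<kappa> * y))) \<and>
        (\<forall>\<alpha>1 c.
          (let \<alpha> = [\<alpha>1, 0, 1, - c - of_nat CARD('r)] in
           admissible [3, 1] \<alpha> X \<and> twisted_chain [3, 1] \<alpha> (x_mat [3, 1] X) C \<longrightarrow>
             (\<exists>y. has_dU_integral
                (\<lambda>U. {etr (U ** X - (1/2) *\<^sub>R (U ** U))} * mpow (det U) (- c - of_nat CARD('r))) C y \<and>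
                radon_hgf [3, 1] (x_mat [3, 1] X) \<alpha> C = \<kappa> * y))) \<and>
        (\<forall>\<alpha>1.
          (let \<alpha> = [\<alpha>1, 0, 0, 1] in
           admissible [4] \<alpha> X \<and> twisted_chain [4] \<alpha> (x_mat [4] X) C \<longrightarrow>
             (\<exists>y. has_dU_integral (\<lambda>U. {etr (U ** X + (1/3) *\<^sub>R (U ** U ** U))}) C y \<and>
                radon_hgf [4] (x_mat [4] X) \<alpha> C = \<kappa> * y))) \<and>
        (\<forall>\<alpha>1.
          (let \<alpha> = [\<alpha>1, 0, 0, - 1] in
           admissible [4] \<alpha> (- X) \<and> twisted_chain [4] \<alpha> (x_mat [4] (- X)) C \<longrightarrow>
             (\<exists>y. has_dU_integral (\<lambda>U. {etr (U ** X - (1/3) *\<^sub>R (U ** U ** U))}) C y \<and>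
                radon_hgf [4] (x_mat [4] (- X)) \<alpha> C = \<kappa> * y)))))"
proof (intro conjI)
  show "subspace {U :: 'r cmat. hermitian U}"
    by (rule subspace_hermitian)
  show "dim {U :: 'r cmat. hermitian U} = CARD('r) * CARD('r)"
    by (rule dim_hermitian)
  show "\<forall>M :: 'r cmat. \<exists>!(A, B). hermitian A \<and> hermitian B \<and> M = A + mat \<i> ** B"
    using hermitian_decomposition by (rule allI)
\<comment> \<open>One \<kappa>, the determinant of the passage from real coordinates to entries,
  serves all types. Each remaining integral representation is a transfer lemma with the value
  inclusion of its normal form; unfolding \<open>twisted_cycle\<close> supplies the chain and
  \<open>list.distinct\<close> shows that the partition is nonempty.\<close>
qed (intro allI impI conjI exI [of _ "det (herm_entry :: complex^('r \<times> 'r)^('r \<times> 'r))"] det_herm_entry du_form_hermitian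
    has_du_integral_radon_hgf
    has_dU_integral_radon_hgf [OF _ _ _ _ _ du_form_hermitian] radon_hgf_gauss_domain
    chart_values_1111 chart_values_211 chart_values_22 chart_values_31 chart_values_4
    chart_values_gauss chart_values_kummer chart_values_bessel chart_values_hermite_weber chart_values_airy
    chart_values_airy_minus x_mat_0 | elim conjE | simp only: twisted_cycle_def Let_def list.distinct not_False_eq_True | fast)+

end
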